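(* Let $a,b\in[0,1]$ and let $(X_n)_{n\ge 0}$ be a homogeneous Markov chain with state space the two-letter ordered alphabet $\{\alpha_1<\alpha_2\}$ and transition probabilities $\mathbb{P}(X_{n+1}=\alpha_2\mid X_n=\alpha_1)=a$ and $\mathbb{P}(X_{n+1}=\alpha_1\mid X_n=\alpha_2)=b$. Let the law of $X_0$ be the invariant distribution $(\pi_1,\pi_2)=\left(\frac{b}{a+b},\frac{a}{a+b}\right)$ if $0<a+b\le 2$, and $(\pi_1,\pi_2)=(1,0)$ if $a=b=0$ (where $\pi_i=\mathbb{P}(X_0=\alpha_i)$). Let $R^1_n$ and $R^2_n$ be the lengths of the first and second rows of the Robinson-Schensted-Knuth (RSK) Young diagram associated with the word $X_1\cdots X_n$. Then, as $n\to\infty$: (i) If $a=b>0$, then $$\left(\frac{R^1_n-n/2}{\sqrt n},\frac{R^2_n-n/2}{\sqrt n}\right)\Rightarrow Y_\infty:=(R^1_\infty,R^2_\infty),$$ where the law of $Y_\infty$ is supported on the second main diagonal $\{(x,-x):x\in\mathbb{R}\}$ of $\mathbb{R}^2$, and $$R^1_\infty\stackrel{\mathcal L}{=}\sqrt{\frac{1-a}{a}}\left(-\frac12 B(1)+\max_{0\le t\le 1}B(t)\right),$$ with $(B(t))_{0\le t\le 1}$ a standard Brownian motion. (ii) If $a\neq b$ or $a=b=0$, then, setting $\pi_{max}=\max\{\pi_1,\pi_2\}$ and $\pi_{min}=\min\{\pi_1,\pi_2\}$, $$\left(\frac{R^1_n-n\pi_{max}}{\sqrt n},\frac{R^2_n-n\pi_{min}}{\sqrt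 n}\right)\Rightarrow N((0,0),\tilde\Sigma),$$ where $N((0,0),\tilde\Sigma)$ is the centered (possibly degenerate) bivariate normal law with covariance matrix $$\tilde\Sigma=\frac{\tilde\sigma^2}{4}\begin{pmatrix}1&-1\\-1&1\end{pmatrix},$$ with $\tilde\sigma^2=4ab(2-a-b)/(a+b)^3$ for $a\ne b$, and $\tilde\sigma^2=0$ for $a=b=0$.
   Context: The symbol $\Rightarrow$ denotes weak convergence of the joint law of the vectors, and $\stackrel{\mathcal L}{=}$ denotes equality in law. For a word on two letters the RSK Young diagram has at most two rows; the length $R^1_n$ of the top row equals $LI_n$, the length of the longest weakly increasing subsequence of $X_1,\dots,X_n$ (the largest $k$ such that $X_{i_1}\le\dots\le X_{i_k}$ for some $1\le i_1<\dots<i_k\le n$, in the order $\alpha_1<\alpha_2$), and the length of the second row is $R^2_n=n-LI_n$ (possibly zero). Normal laws with zero variance are understood to be degenerate at the origin; likewise the limit in (i) is degenerate at the origin when $a=b=1$. *)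

theory Defs
  imports "HOL-Probability.Probability"
begin

datatype letter = Alpha1 | Alpha2

instantiation letter :: linorder
begin

definition less_eq_letter :: "letter \<Rightarrow> letter \<Rightarrow> bool" where
  "x \<le> y \<longleftrightarrow> x = Alpha1 \<or> y = Alpha2"

definition less_letter :: "letter \<Rightarrow> letter \<Rightarrow> bool" where
  "x < y \<longleftrightarrow> x = Alpha1 \<and> y = Alpha2"

instance
proof
  fix x y z :: letter
  show "(x < y) = (x \<le> y \<and> \<not> y \<le> x)"
    by (cases x; cases y) (simp_all add: less_eq_letter_def less_letter_def)
  show "x \<le> x"
    by (cases x) (simp_all add: less_eq_letter_def)
  show "x \<le> y \<Longrightarrow> y \<le> z \<Longrightarrow> x \<le> z"
    by (cases x; cases y; cases z) (simp_all add: less_eq_letter_def)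
  show "x \<le> y \<Longrightarrow> y \<le> x \<Longrightarrow> x = y"
    by (cases x; cases y) (simp_all add: less_eq_letter_def)
  show "x \<le> y \<or> y \<le> x"
    by (cases x; cases y) (simp_all add: less_eq_letter_def)
qed

end


section \<open>The RSK Young diagram of a word\<close>

text \<open>Row insertion into a weakly increasing row: \<open>x\<close> replaces the leftmost entry that is
  strictly larger than \<open>x\<close>, and that entry is returned; if there is none, \<open>x\<close> is appended.\<close>

fun row_insert :: "'a::linorder \<Rightarrow> 'a list \<Rightarrow> 'a list \<times> 'a option" where
  "row_insert x [] = ([x], None)"
| "row_insert x (y # ys) =
     (if x < y then (x # ys, Some y)
      else (case row_insert x ys of (zs, bumped) \<Rightarrow> (y # zs, bumped)))"

text \<open>A tableau is its list of rows, top row first.\<close>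

fun tableau_insert :: "'a::linorder \<Rightarrow> 'a list list \<Rightarrow> 'a list list" where
  "tableau_insert x [] = [[x]]"
| "tableau_insert x (r # rs) =
     (case row_insert x r of
        (r', None) \<Rightarrow> r' # rs
      | (r', Some y) \<Rightarrow> r' # tableau_insert y rs)"

definition rsk_tableau :: "'a::linorder list \<Rightarrow> 'a list list" where
  "rsk_tableau w = fold tableau_insert w []"

text \<open>The insertion tableau and the recording tableau have the same shape, so the insertion
  tableau suffices for the Young diagram. Rows are numbered from 1; absent rows have length 0.\<close>

definition rsk_row_length :: "nat \<Rightarrow> 'a::linorder list \<Rightarrow> nat" where
  "rsk_row_length i w =
     (if 1 \<le> i \<and> i \<le> length (rsk_tableau w) then length (rsk_tableau w ! (i - 1)) else 0)"

definition row_len :: "(nat \<Rightarrow> 'w \<Rightarrow> 'a::linorder) \<Rightarrow> nat \<Rightarrow> nat \<Rightarrow> 'w \<Rightarrow> nat" where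
  "row_len X i n \<omega> = rsk_row_length i (map (\<lambda>k. X k \<omega>) [1..<Suc n])"


section \<open>Markov chains\<close>

text \<open>The transition probabilities are only constrained along histories of positive probability,
  where the conditional probability is meaningful.\<close>

definition markov_chain ::
  "'w measure \<Rightarrow> (nat \<Rightarrow> 'w \<Rightarrow> 's) \<Rightarrow> ('s \<Rightarrow> real) \<Rightarrow> ('s \<Rightarrow> 's \<Rightarrow> real) \<Rightarrow> bool" where
  "markov_chain M X init p \<longleftrightarrow>
     prob_space M \<and>
     (\<forall>n. X n \<in> measurable M (count_space UNIV)) \<and>
     (\<forall>x. \<P>(\<omega> in M. X 0 \<omega> = x) = init x) \<and>
     (\<forall>n x y. \<P>(\<omega> in M. \<forall>k\<le>n. X k \<omega> = x k) > 0 \<longrightarrow>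
        \<P>(\<omega> in M. X (Suc n) \<omega> = y \<bar> \<forall>k\<le>n. X k \<omega> = x k) = p (x n) y)"

fun trans_prob :: "real \<Rightarrow> real \<Rightarrow> letter \<Rightarrow> letter \<Rightarrow> real" where
  "trans_prob a b Alpha1 Alpha1 = 1 - a"
| "trans_prob a b Alpha1 Alpha2 = a"
| "trans_prob a b Alpha2 Alpha1 = b"
| "trans_prob a b Alpha2 Alpha2 = 1 - b"

fun init_prob :: "real \<Rightarrow> real \<Rightarrow> letter \<Rightarrow> real" where
  "init_prob a b Alpha1 = (if a = 0 \<and> b = 0 then 1 else b / (a + b))"
| "init_prob a b Alpha2 = (if a = 0 \<and> b = 0 then 0 else a / (a + b))"


section \<open>Weak convergence, Gaussian laws and Brownian motion\<close>

definition weakly_converges ::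
  "(nat \<Rightarrow> 'a::topological_space measure) \<Rightarrow> 'a measure \<Rightarrow> bool" where
  "weakly_converges \<mu> \<nu> \<longleftrightarrow>
     (\<forall>f :: 'a \<Rightarrow> real. continuous_on UNIV f \<and> bounded (range f) \<longrightarrow>
        (\<lambda>n. integral\<^sup>L (\<mu> n) f) \<longlonglongrightarrow> integral\<^sup>L \<nu> f)"

text \<open>Second argument: the variance, not the standard deviation.\<close>

definition normal_law :: "real \<Rightarrow> real \<Rightarrow> real measure" where
  "normal_law m v =
     (if v = 0 then return borel m else density lborel (\<lambda>x. ennreal (normal_density m (sqrt v) x)))"

text \<open>The possibly degenerate Gaussian law with mean \<open>m\<close> and covariance matrix \<open>S\<close>: the law under
  which every linear functional \<open>u \<bullet> x\<close> is normal with mean \<open>u \<bullet> m\<close> and variance \<open>u \<bullet> S u\<close>.\<close>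

definition multivariate_normal ::
  "(real ^ 'n) measure \<Rightarrow> real ^ 'n \<Rightarrow> real ^ 'n ^ 'n \<Rightarrow> bool" where
  "multivariate_normal \<nu> m S \<longleftrightarrow>
     prob_space \<nu> \<and> sets \<nu> = sets borel \<and>
     transpose S = S \<and> (\<forall>u. 0 \<le> u \<bullet> (S *v u)) \<and>
     (\<forall>u. distr \<nu> borel (\<lambda>x. u \<bullet> x) = normal_law (u \<bullet> m) (u \<bullet> (S *v u)))"

text \<open>Standard Brownian motion indexed by \<open>[0,1]\<close>. All paths, not just almost all, start at 0 and
  are continuous; this makes the running maximum measurable without completing \<open>N\<close>.\<close>

definition standard_brownian_motion :: "'w measure \<Rightarrow> (real \<Rightarrow> 'w \<Rightarrow> real) \<Rightarrow> bool" where
  "standard_brownian_motion N B \<longleftrightarrow>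
     prob_space N \<and>
     (\<forall>t\<in>{0..1}. B t \<in> borel_measurable N) \<and>
     (\<forall>\<omega>\<in>space N. B 0 \<omega> = 0 \<and> continuous_on {0..1} (\<lambda>t. B t \<omega>)) \<and>
     (\<forall>s t. 0 \<le> s \<and> s < t \<and> t \<le> 1 \<longrightarrow>
        distr N borel (\<lambda>\<omega>. B t \<omega> - B s \<omega>) = normal_law 0 (t - s)) \<and>
     (\<forall>k t. 0 \<le> t 0 \<and> (\<forall>i<k. t i < t (Suc i)) \<and> t k \<le> 1 \<longrightarrow>
        prob_space.indep_vars N (\<lambda>_. borel) (\<lambda>i \<omega>. B (t (Suc i)) \<omega> - B (t i) \<omega>) {..<k})"

end

theory Submission
  imports Defs "HOL-Real_Asymp.Real_Asymp"
begin

text \<open>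
  Read \<open>Alpha1\<close> as a step up and \<open>Alpha2\<close> as a step down, and let \<open>S\<close> be the end point and \<open>M\<close> the
  maximum of the resulting walk of length \<open>n\<close>, started at 0. Row insertion on two letters acts on the
  number of letters \<open>Alpha2\<close> in the top row as a queue, which gives the top row the length
  \<open>n / 2 - S / 2 + M\<close> (\<open>rsk_row_lengths\<close>). The second row is \<open>n\<close> minus the first, so after centring the
  pair of rows lies on the antidiagonal, and only the law of one real variable has to be followed.

  The walk is an additive functional of a two-state chain. Its characteristic functions come from the
  powers of a perturbed transition operator, whose leading eigenvector and eigenvalue are known
  explicitly up to an error of third order; this gives a central limit theorem from any starting
  letter (\<open>char_centred_sum_tendsto\<close>).
  Hoeffding's lemma for the associated martingale gives exponential bounds, also for the maximum
  (\<open>walk_max_tail\<close>).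

  If \<open>a \<noteq> b\<close>, the walk has a drift. Then \<open>M\<close>, or \<open>M - S\<close> when the drift is upwards, has mean
  \<open>O(ln n)\<close>, so the top row is, up to \<open>o(sqrt n)\<close>, the number of occurrences of the more frequent
  letter, and its limit is normal (\<open>char_top_row_biased\<close>). For \<open>a = b = 0\<close> the word is constant.

  If \<open>a = b > 0\<close>, the walk is centred and \<open>M\<close> matters on the scale \<open>sqrt n\<close>. The word is cut into \<open>m\<close>
  blocks of equal length. For fixed \<open>m\<close>, the walk and its maximum observed at the block ends converge
  to a Gaussian walk with \<open>m\<close> steps and its maximum (\<open>block_grid_limit\<close>), and this limit is exactly
  Brownian motion of variance \<open>(1 - a) / a\<close> observed at the times \<open>i / m\<close> (\<open>gauss_step_brownian_grid\<close>).
  By the maximal inequality, what the walk does between the block ends becomes negligible as \<open>m\<close>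
  grows, uniformly in large \<open>n\<close> (\<open>grid_approximation\<close>), and continuity of paths does the same for Brownian
  motion.
\<close>

section \<open>The diagram of a two-letter word as a functional of a walk\<close>

fun step :: "letter \<Rightarrow> real" where
  "step Alpha1 = 1"
| "step Alpha2 = -1"

definition walk_end :: "letter list \<Rightarrow> real" where
  "walk_end w = (\<Sum>x\<leftarrow>w. step x)"

fun walk_max :: "letter list \<Rightarrow> real" where
  "walk_max [] = 0"
| "walk_max (x # w) = max 0 (step x + walk_max w)"

lemma walk_end_simps [simp]:
  "walk_end [] = 0" "walk_end (x # w) = step x + walk_end w"
  "walk_end (u @ v) = walk_end u + walk_end v"
  by (simp_all add: walk_end_def)

lemma walk_max_nonneg [simp]: "0 \<le> walk_max w"
  by (cases w) auto

lemma walk_end_le_max: "walk_end w \<le> walk_max w"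
  by (induction w) auto

lemma walk_max_append: "walk_max (u @ v) = max (walk_max u) (walk_end u + walk_max v)"
  by (induction u) (auto simp: max_def add.assoc)

lemma abs_step [simp]: "\<bar>step x\<bar> = 1"
  by (cases x) auto

lemma abs_walk_end_le: "\<bar>walk_end w\<bar> \<le> length w"
proof (induction w)
  case (Cons x w)
  have "\<bar>step x + walk_end w\<bar> \<le> \<bar>step x\<bar> + \<bar>walk_end w\<bar>" by (rule abs_triangle_ineq)
  with Cons show ?case by (simp del: abs_triangle_ineq)
qed simp

lemma walk_max_le_length: "walk_max w \<le> length w"
proof (induction w)
  case (Cons x w)
  then show ?case by (cases x) auto
qed simp

text \<open>The length of the longest weakly increasing subsequence: cutting the word after its first \<open>k\<close>
  letters and keeping the letters \<open>Alpha1\<close> before and \<open>Alpha2\<close> after the cut leaves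
  \<open>(length w - walk_end w) / 2\<close> plus the height of the walk at time \<open>k\<close>; the best cut is where
  the walk is maximal.\<close>

definition top_row :: "letter list \<Rightarrow> real" where
  "top_row w = walk_max w + (length w - walk_end w) / 2"

lemma less_letter_simps [simp]:
  "\<not> (x::letter) < Alpha1" "\<not> Alpha2 < (x::letter)" "Alpha1 < Alpha2"
  by (cases x; simp add: less_letter_def)+

lemma row_insert_Alpha2:
  "row_insert Alpha2 r = (r @ [Alpha2], None)"
  by (induction r) auto

lemma row_insert_Alpha1:
  "row_insert Alpha1 (replicate p Alpha1 @ replicate q Alpha2) =
     (if q = 0 then (replicate (Suc p) Alpha1, None)
      else (replicate (Suc p) Alpha1 @ replicate (q - 1) Alpha2, Some Alpha2))"
  by (induction p) (cases q; simp)+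

text \<open>Absent rows are omitted, as the insertion algorithm never creates an empty row.\<close>

definition shape_tableau :: "nat \<Rightarrow> nat \<Rightarrow> nat \<Rightarrow> letter list list" where
  "shape_tableau p q r =
     (if p + q = 0 then [] else [replicate p Alpha1 @ replicate q Alpha2]) @
     (if r = 0 then [] else [replicate r Alpha2])"

text \<open>Only \<open>Alpha2\<close> can be bumped, and in the second row it is appended; so a tableau is given by three
  counts. The number \<open>q\<close> of letters \<open>Alpha2\<close> in the top row is a queue length: \<open>Alpha2\<close> is an
  arrival, \<open>Alpha1\<close> a service that is wasted when the queue is empty. This is the recursion of the
  walk reflected at its running maximum, whence \<open>q = walk_max w - walk_end w\<close>.\<close>

lemma rsk_tableau_two_letters:
  "\<exists>p q r. rsk_tableau w = shape_tableau p q r \<and> p + q + r = length w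
     \<and> real q = walk_max w - walk_end w \<and> real p = (length w + walk_end w) / 2
     \<and> (r > 0 \<longrightarrow> p + q > 0)"
proof (induction w rule: rev_induct)
  case Nil
  show ?case by (rule exI[of _ 0])+ (simp add: rsk_tableau_def shape_tableau_def)
next
  case (snoc x w)
  then obtain p q r where *: "rsk_tableau w = shape_tableau p q r" "p + q + r = length w"
    "real q = walk_max w - walk_end w" "real p = (length w + walk_end w) / 2" "r > 0 \<longrightarrow> p + q > 0"
    by blast
  have t: "rsk_tableau (w @ [x]) = tableau_insert x (shape_tableau p q r)"
    using *(1) by (simp add: rsk_tableau_def)
  have m: "walk_max (w @ [x]) = max (walk_max w) (walk_end w + step x)"
    using walk_end_le_max[of w] by (cases x) (auto simp: walk_max_append)
  show ?case
  proof (cases x)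
    case Alpha2
    have "rsk_tableau (w @ [x]) = shape_tableau p (Suc q) r"
      unfolding t unfolding Alpha2 using *(5)
      by (auto simp: shape_tableau_def row_insert_Alpha2 replicate_append_same)
    moreover have "walk_max (w @ [x]) = walk_max w"
      using m walk_end_le_max[of w] Alpha2 by simp
    ultimately show ?thesis using * Alpha2
      by (intro exI[of _ p] exI[of _ "Suc q"] exI[of _ r]) simp
  next
    case A1: Alpha1
    show ?thesis
    proof (cases "q = 0")
      case True
      have "rsk_tableau (w @ [x]) = shape_tableau (Suc p) 0 r"
        unfolding t unfolding A1 using *(5) True row_insert_Alpha1[of p 0]
        by (auto simp: shape_tableau_def)
      moreover have "walk_max (w @ [x]) = walk_end w + 1"
        using m * True A1 by simp
      ultimately show ?thesis using * A1 True
        by (intro exI[of _ "Suc p"] exI[of _ 0] exI[of _ r]) (simp add: field_simps)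
    next
      case False
      have "rsk_tableau (w @ [x]) = shape_tableau (Suc p) (q - 1) (Suc r)"
        unfolding t unfolding A1 using False row_insert_Alpha1[of p q]
        by (auto simp: shape_tableau_def row_insert_Alpha2 replicate_append_same)
      moreover have "walk_max (w @ [x]) = walk_max w"
        using m *(3) False A1 by simp
      ultimately show ?thesis using * A1 False
        by (intro exI[of _ "Suc p"] exI[of _ "q - 1"] exI[of _ "Suc r"])
           (auto simp: field_simps of_nat_diff)
    qed
  qed
qed

lemma rsk_row_lengths:
  "real (rsk_row_length 1 w) = top_row w"
  "real (rsk_row_length 2 w) = length w - top_row w"
proof -
  obtain p q r where *: "rsk_tableau w = shape_tableau p q r" "p + q + r = length w"
    "real q = walk_max w - walk_end w" "real p = (length w + walk_end w) / 2" "r > 0 \<longrightarrow> p + q > 0"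
    using rsk_tableau_two_letters[of w] by blast
  have 1: "rsk_row_length 1 w = p + q" and 2: "rsk_row_length 2 w = r"
    using *(1,5) by (auto simp: rsk_row_length_def shape_tableau_def split: if_splits)
  have "real (p + q) = top_row w" using *(3,4) by (simp add: top_row_def field_simps)
  moreover from *(2) have "real r = length w - real (p + q)" by linarith
  ultimately show "real (rsk_row_length 1 w) = top_row w"
    "real (rsk_row_length 2 w) = length w - top_row w" using 1 2 by simp_all
qed

section \<open>The law of the word\<close>

lemma UNIV_letter: "(UNIV :: letter set) = {Alpha1, Alpha2}"
  using letter.exhaust by auto

instance letter :: finite
  by standard (simp add: UNIV_letter)

lemma sum_letter: "(\<Sum>y\<in>UNIV. f y) = f Alpha1 + f Alpha2"
  by (simp add: UNIV_letter)

locale two_letter_chain =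
  fixes a b :: real
  assumes a01: "0 \<le> a" "a \<le> 1" and b01: "0 \<le> b" "b \<le> 1"
begin

definition step_law :: "letter \<Rightarrow> letter pmf" where
  "step_law z = map_pmf (\<lambda>c. if c then Alpha2 else Alpha1) (bernoulli_pmf (trans_prob a b z Alpha2))"

primrec word_law :: "nat \<Rightarrow> letter \<Rightarrow> letter list pmf" where
  "word_law 0 z = return_pmf []"
| "word_law (Suc n) z = bind_pmf (step_law z) (\<lambda>y. map_pmf ((#) y) (word_law n y))"

definition init_law :: "letter pmf" where
  "init_law = map_pmf (\<lambda>c. if c then Alpha2 else Alpha1) (bernoulli_pmf (init_prob a b Alpha2))"

definition chain_law :: "nat \<Rightarrow> letter list pmf" where
  "chain_law n = bind_pmf init_law (word_law n)"

lemma pmf_coin_letter: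
  assumes "0 \<le> q" "q \<le> 1"
  shows "pmf (map_pmf (\<lambda>c. if c then Alpha2 else Alpha1) (bernoulli_pmf q)) y
    = (case y of Alpha1 \<Rightarrow> 1 - q | Alpha2 \<Rightarrow> q)"
proof -
  have "inj (\<lambda>c. if c then Alpha2 else Alpha1)" by (auto simp: inj_def split: if_splits)
  from pmf_map_inj'[OF this, of "bernoulli_pmf q" False] pmf_map_inj'[OF this, of "bernoulli_pmf q" True]
  show ?thesis using assms by (cases y) simp_all
qed

lemma pmf_step_law [simp]: "pmf (step_law z) y = trans_prob a b z y"
  using a01 b01 unfolding step_law_def by (subst pmf_coin_letter) (cases z; cases y; simp)+

lemma pmf_init_law [simp]: "pmf init_law y = init_prob a b y"
proof -
  have "a / (a + b) \<le> 1" using a01 b01 by (cases "a + b = 0") (auto simp: divide_le_eq_1)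
  moreover have "b / (a + b) = 1 - a / (a + b)" if "a \<noteq> 0 \<or> b \<noteq> 0"
  proof -
    have "a + b \<noteq> 0" using that a01 b01 by linarith
    then show ?thesis by (simp add: field_simps)
  qed
  ultimately show ?thesis using a01 b01 unfolding init_law_def
    by (subst pmf_coin_letter) (cases y; auto)+
qed

lemma finite_set_letter_pmf [simp]: "finite (set_pmf (p :: letter pmf))"
  by (rule finite_subset[of _ UNIV]) auto

lemma set_word_law: "set_pmf (word_law n z) \<subseteq> {w. length w = n}"
proof (induction n arbitrary: z)
  case (Suc n)
  then show ?case by fastforce
qed simp

lemma finite_words: "finite {w :: letter list. length w = n}"
  using finite_lists_length_eq[of "UNIV :: letter set" n] by simp

lemma finite_set_word_law [simp]: "finite (set_pmf (word_law n z))"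
  using finite_subset[OF set_word_law finite_words] .

lemma expectation_letter:
  fixes f :: "letter \<Rightarrow> 'c::{banach, second_countable_topology}"
  shows "measure_pmf.expectation p f = pmf p Alpha1 *\<^sub>R f Alpha1 + pmf p Alpha2 *\<^sub>R f Alpha2"
  by (subst integral_measure_pmf[of UNIV]) (auto simp: sum_letter)

lemma expectation_bind_letter:
  fixes h :: "'d \<Rightarrow> 'c::{banach, second_countable_topology}"
  assumes "\<And>y. finite (set_pmf (f y))"
  shows "measure_pmf.expectation (bind_pmf (p :: letter pmf) f) h =
    pmf p Alpha1 *\<^sub>R measure_pmf.expectation (f Alpha1) h
      + pmf p Alpha2 *\<^sub>R measure_pmf.expectation (f Alpha2) h"
  by (subst pmf_expectation_bind[of UNIV]) (auto simp: sum_letter assms)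

lemma expectation_word_law_Suc:
  fixes h :: "letter list \<Rightarrow> 'c::{banach, second_countable_topology}"
  shows "measure_pmf.expectation (word_law (Suc n) z) h =
    measure_pmf.expectation (step_law z) (\<lambda>y. measure_pmf.expectation (word_law n y) (\<lambda>w. h (y # w)))"
  by (simp add: expectation_bind_letter expectation_letter)

lemma expectation_chain_law:
  fixes h :: "letter list \<Rightarrow> 'c::{banach, second_countable_topology}"
  shows "measure_pmf.expectation (chain_law n) h =
    measure_pmf.expectation init_law (\<lambda>z. measure_pmf.expectation (word_law n z) h)"
  by (simp add: chain_law_def expectation_bind_letter expectation_letter)

text \<open>The Markov property at time \<open>n\<close>: the rest of the word depends on the past only through its last
  letter.\<close>

lemma word_law_append:
  "word_law (n + k) z =
     bind_pmf (word_law n z) (\<lambda>u. map_pmf ((@) u) (word_law k (last (z # u))))"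
proof (induction n arbitrary: z)
  case 0
  have "map_pmf ((@) []) p = p" for p :: "letter list pmf"
    by (simp add: pmf.map_ident_strong)
  then show ?case by (simp add: bind_return_pmf)
next
  case (Suc n)
  have "(@) (y # u) = (\<lambda>v. y # u @ v)" for y and u :: "letter list"
    by auto
  then show ?case
    by (simp add: Suc.IH bind_assoc_pmf map_bind_pmf bind_map_pmf pmf.map_comp o_def)
qed

fun word_weight :: "letter \<Rightarrow> letter list \<Rightarrow> real" where
  "word_weight z [] = 1"
| "word_weight z (y # w) = trans_prob a b z y * word_weight y w"

lemma pmf_word_law: "pmf (word_law (length w) z) w = word_weight z w"
proof (induction w arbitrary: z)
  case (Cons x w)
  have "pmf (map_pmf ((#) y) (word_law (length w) y)) (x # w)
      = (if y = x then word_weight x w else 0)" for y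
  proof (cases "y = x")
    case True
    have "inj ((#) x)" by (auto simp: inj_def)
    from pmf_map_inj'[OF this] show ?thesis using True Cons by simp
  next
    case False
    then show ?thesis by (auto simp: pmf_eq_0_set_pmf)
  qed
  then show ?case
    by (cases x) (simp_all add: pmf_bind expectation_letter)
qed simp

lemma word_weight_snoc:
  "word_weight z (w @ [y]) = word_weight z w * trans_prob a b (last (z # w)) y"
  by (induction w arbitrary: z) auto

end

text \<open>A history of probability zero carries no conditional probability, but then its extensions have
  probability zero as well, so the product formula holds for all paths.\<close>

lemma markov_chain_path_prob:
  assumes mc: "markov_chain M X (init_prob a b) (trans_prob a b)"
    and ch: "two_letter_chain a b"
  shows "\<P>(\<omega> in M. \<forall>k\<le>n. X k \<omega> = x k)
    = init_prob a b (x 0) * two_letter_chain.word_weight a b (x 0) (map x [1..<Suc n])"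
proof -
  interpret two_letter_chain a b by fact
  have ps: "prob_space M" and rv [measurable]: "\<And>n. X n \<in> measurable M (count_space UNIV)"
    and init: "\<And>x. \<P>(\<omega> in M. X 0 \<omega> = x) = init_prob a b x"
    and trans: "\<And>n x y. \<P>(\<omega> in M. \<forall>k\<le>n. X k \<omega> = x k) > 0 \<Longrightarrow>
        \<P>(\<omega> in M. X (Suc n) \<omega> = y \<bar> \<forall>k\<le>n. X k \<omega> = x k) = trans_prob a b (x n) y"
    using mc unfolding markov_chain_def by blast+
  interpret prob_space M by fact
  show ?thesis
  proof (induction n)
    case 0
    show ?case using init[of "x 0"] by simp
  next
    case (Suc n)
    let ?A = "\<lambda>n. {\<omega> \<in> space M. \<forall>k\<le>n. X k \<omega> = x k}"
    have last: "last (x 0 # map x [1..<Suc n]) = x n"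
      by (cases n) auto
    have sets: "?A n \<in> sets M" for n by measurable
    have A_eq: "?A (Suc n) = {\<omega> \<in> space M. X (Suc n) \<omega> = x (Suc n) \<and> (\<forall>k\<le>n. X k \<omega> = x k)}"
      by (auto simp: le_Suc_eq)
    have "prob (?A (Suc n)) = prob (?A n) * trans_prob a b (x n) (x (Suc n))"
    proof (cases "prob (?A n) > 0")
      case True
      from trans[OF True, of "x (Suc n)"] True show ?thesis
        unfolding cond_prob_def A_eq by (simp add: field_simps)
    next
      case False
      then have "prob (?A n) = 0" using measure_nonneg[of M "?A n"] by linarith
      moreover have "prob (?A (Suc n)) \<le> prob (?A n)"
        by (rule finite_measure_mono[OF _ sets]) auto
      ultimately show ?thesis using measure_nonneg[of M "?A (Suc n)"] by simp
    qed
    also have "\<dots> = init_prob a b (x 0) * word_weight (x 0) (map x [1..<Suc n] @ [x (Suc n)])"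
      using Suc last by (simp add: word_weight_snoc)
    finally show ?case by simp
  qed
qed

text \<open>The theorem depends on the chain only through the laws of its finite words, which are the finitely
  supported distributions \<open>chain_law n\<close>. From here on probabilities are finite sums, and the Markov
  property is the recursion defining \<open>word_law\<close>.\<close>

lemma markov_chain_word_law:
  assumes mc: "markov_chain M X (init_prob a b) (trans_prob a b)"
    and ch: "two_letter_chain a b"
  shows "(\<lambda>\<omega>. map (\<lambda>k. X k \<omega>) [1..<Suc n]) \<in> measurable M (count_space UNIV)" (is "?W \<in> _")
    and "distr M (count_space UNIV) (\<lambda>\<omega>. map (\<lambda>k. X k \<omega>) [1..<Suc n])
      = measure_pmf (two_letter_chain.chain_law a b n)"
proof -
  interpret two_letter_chain a b by fact
  have ps: "prob_space M" and rv [measurable]: "\<And>n. X n \<in> measurable M (count_space UNIV)"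
    using mc unfolding markov_chain_def by blast+
  interpret prob_space M by fact
  have len: "?W \<omega> = w \<longleftrightarrow> length w = n \<and> (\<forall>k\<in>{1..n}. X k \<omega> = (undefined # w) ! k)" for \<omega> w
  proof
    assume "?W \<omega> = w"
    then show "length w = n \<and> (\<forall>k\<in>{1..n}. X k \<omega> = (undefined # w) ! k)"
      by (auto simp: nth_Cons' simp del: upt_Suc)
  next
    assume *: "length w = n \<and> (\<forall>k\<in>{1..n}. X k \<omega> = (undefined # w) ! k)"
    show "?W \<omega> = w"
    proof (rule nth_equalityI)
      fix i assume "i < length (?W \<omega>)"
      then have "Suc i \<in> {1..n}" "i < n" by (auto simp del: upt_Suc)
      with * have "X (Suc i) \<omega> = (undefined # w) ! Suc i" by blast
      with \<open>i < n\<close> show "?W \<omega> ! i = w ! i" by (simp del: upt_Suc)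
    qed (use * in simp)
  qed
  have sets_W: "{\<omega> \<in> space M. ?W \<omega> = w} \<in> sets M" for w
    unfolding len by measurable
  show meas: "?W \<in> measurable M (count_space UNIV)"
    using sets_W by (subst measurable_count_space_eq_countable) (auto simp: vimage_def Int_def conj_commute simp del: upt_Suc)
  show "distr M (count_space UNIV) ?W = measure_pmf (chain_law n)" (is "?L = ?R")
  proof (rule measure_eqI_countable[where A = UNIV])
    fix w :: "letter list"
    have "emeasure ?L {w} = ennreal (prob {\<omega> \<in> space M. ?W \<omega> = w})"
      using meas by (subst emeasure_distr)
        (auto simp: emeasure_eq_measure vimage_def Int_def conj_commute simp del: upt_Suc)
    also have "prob {\<omega> \<in> space M. ?W \<omega> = w} = pmf (chain_law n) w"
    proof (cases "length w = n")
      case True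
      \<comment> \<open>The path formula also fixes the letter at time 0, which is not part of the word; it is summed out.\<close>
      have ev: "{\<omega> \<in> space M. X 0 \<omega> = z \<and> ?W \<omega> = w} = {\<omega> \<in> space M. \<forall>k\<le>n. X k \<omega> = (z # w) ! k}" for z
      proof -
        have "(X 0 \<omega> = z \<and> ?W \<omega> = w) \<longleftrightarrow> (\<forall>k\<le>n. X k \<omega> = (z # w) ! k)" for \<omega>
          unfolding len using True
          by (auto simp: nth_Cons' Ball_def less_Suc_eq_le Suc_le_eq split: if_splits)
        then show ?thesis by blast
      qed
      have nth: "map ((!) (z # w)) [1..<Suc n] = w" for z
        using True by (intro nth_equalityI) (auto simp del: upt_Suc)
      have "prob {\<omega> \<in> space M. ?W \<omega> = w} = (\<Sum>z\<in>UNIV. prob {\<omega> \<in> space M. X 0 \<omega> = z \<and> ?W \<omega> = w})"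
      proof (subst finite_measure_finite_Union[symmetric])
        show "(\<lambda>z. {\<omega> \<in> space M. X 0 \<omega> = z \<and> ?W \<omega> = w}) ` UNIV \<subseteq> sets M"
          unfolding len by (auto intro!: measurable)
      qed (auto simp: disjoint_family_on_def intro!: arg_cong[where f = prob])
      also have "\<dots> = (\<Sum>z\<in>UNIV. init_prob a b z * word_weight z w)"
        unfolding ev markov_chain_path_prob[OF mc ch] nth by simp
      also have "\<dots> = pmf (chain_law n) w"
        using pmf_word_law[of w] True by (simp add: chain_law_def pmf_bind expectation_letter sum_letter)
      finally show ?thesis .
    next
      case False
      have "w \<notin> set_pmf (chain_law n)"
        using set_word_law False by (fastforce simp: chain_law_def)
      then have 0: "pmf (chain_law n) w = 0" by (simp add: set_pmf_eq)
      have none: "{\<omega> \<in> space M. ?W \<omega> = w} = {}" using False by auto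
      show ?thesis unfolding none 0 by simp
    qed
    finally show "emeasure ?L {w} = emeasure ?R {w}" by (simp add: emeasure_pmf_single)
  qed auto
qed

section \<open>Exponential bounds for the walk\<close>

locale mixing_chain = two_letter_chain +
  assumes ab_pos: "0 < a + b"
begin

text \<open>The indicator of \<open>Alpha1\<close> minus its invariant probability \<open>b / (a + b)\<close>. The centred functions of
  one letter form a line, so this is an eigenfunction of the transition operator, with eigenvalue
  \<open>1 - a - b\<close>.\<close>

definition centred :: "letter \<Rightarrow> real" where
  "centred z = (case z of Alpha1 \<Rightarrow> a | Alpha2 \<Rightarrow> - b) / (a + b)"

definition centred_sum :: "letter list \<Rightarrow> real" where
  "centred_sum w = (\<Sum>x\<leftarrow>w. centred x)"

text \<open>With \<open>\<rho> = 1 - a - b\<close> this is \<open>\<rho> / (1 - \<rho>)\<close>, the solution of \<open>(1 + corrector) * \<rho> = corrector\<close>. So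
  \<open>corrector * centred\<close> solves the Poisson equation: the sum of \<open>centred\<close> along the chain, corrected by
  \<open>corrector * centred\<close> of the current letter, is a martingale.\<close>

definition corrector :: real where
  "corrector = (1 - a - b) / (a + b)"

lemma centred_sum_simps [simp]:
  "centred_sum [] = 0" "centred_sum (x # w) = centred x + centred_sum w" "centred_sum (u @ v) = centred_sum u + centred_sum v"
  by (simp_all add: centred_sum_def)

lemma abs_centred_le: "\<bar>centred z\<bar> \<le> 1"
  using ab_pos a01 b01 by (cases z) (auto simp: centred_def divide_le_eq_1)

lemma step_eq_centred: "step z = 2 * centred z + (b - a) / (a + b)"
proof -
  have "a + b \<noteq> 0" using ab_pos by simp
  then show ?thesis by (cases z) (simp_all add: centred_def divide_simps)
qed

lemma walk_end_eq_centred_sum: "walk_end w = 2 * centred_sum w + length w * ((b - a) / (a + b))"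
proof -
  define c where "c = (b - a) / (a + b)"
  have "walk_end w = 2 * centred_sum w + length w * c"
    by (induction w) (simp_all add: step_eq_centred c_def[symmetric] algebra_simps)
  then show ?thesis by (simp add: c_def)
qed

lemma step_law_centred: "measure_pmf.expectation (step_law z) centred = (1 - a - b) * centred z"
proof -
  have "a + b \<noteq> 0" using ab_pos by simp
  then show ?thesis
    by (cases z) (simp_all add: expectation_letter centred_def divide_simps, simp_all add: algebra_simps)
qed

lemma one_plus_corrector: "(1 + corrector) * x = x / (a + b)"
  using ab_pos by (simp add: corrector_def field_simps)

text \<open>One step of the martingale just described. Given the current letter, \<open>(1 + corrector) * centred\<close> takes two
  values at distance \<open>1 / (a + b)\<close> and has mean \<open>corrector * centred z\<close>, so Hoeffding's lemma applies.\<close>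

lemma exp_step:
  "measure_pmf.expectation (step_law z) (\<lambda>y. exp (\<theta> * ((1 + corrector) * centred y)))
    \<le> exp (\<theta> * (corrector * centred z) + \<theta>\<^sup>2 / (8 * (a + b)\<^sup>2))"
proof -
  have pos: "measure_pmf.expectation (step_law z) (\<lambda>y. exp (l * (s * (centred y / (a + b)))))
      \<le> exp (l * (s * (corrector * centred z)) + l\<^sup>2 / (8 * (a + b)\<^sup>2))"
    if "l > 0" "s = 1 \<or> s = -1" for l s :: real
  proof -
    define lo hi where "lo = (if s = 1 then - b else - a) / (a + b)\<^sup>2"
      and "hi = (if s = 1 then a else b) / (a + b)\<^sup>2"
    define f where "f y = s * (centred y / (a + b))" for y
    interpret interval_bounded_random_variable "measure_pmf (step_law z)" f lo hi
    proof
      have "lo \<le> f y \<and> f y \<le> hi" for y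
        using that(2) a01 b01 ab_pos
        by (cases y) (auto simp: f_def centred_def lo_def hi_def power2_eq_square divide_right_mono,
          (rule order_trans[of _ 0], simp, simp)+)
      then show "AE x in measure_pmf (step_law z). f x \<in> {lo..hi}" by auto
    qed auto
    have mean: "measure_pmf.expectation (step_law z) f = s * (corrector * centred z)"
      unfolding f_def using step_law_centred[of z] by (simp add: corrector_def)
    have w: "hi - lo = 1 / (a + b)"
      using ab_pos that(2) by (auto simp: hi_def lo_def power2_eq_square diff_divide_distrib[symmetric] add.commute)
    have int: "integrable (measure_pmf (step_law z)) g" for g :: "letter \<Rightarrow> real"
      by (simp add: integrable_measure_pmf_finite)
    have "ennreal (measure_pmf.expectation (step_law z) (\<lambda>y. exp (l * (f y - s * (corrector * centred z)))))
        \<le> ennreal (exp (l\<^sup>2 * (1 / (a + b))\<^sup>2 / 8))"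
      using Hoeffdings_lemma_nn_integral[OF that(1)] unfolding mean
      by (subst (asm) nn_integral_eq_integral[OF int]) (simp_all add: w)
    then have "measure_pmf.expectation (step_law z) (\<lambda>y. exp (l * (f y - s * (corrector * centred z))))
        \<le> exp (l\<^sup>2 * (1 / (a + b))\<^sup>2 / 8)"
      by simp
    moreover have "measure_pmf.expectation (step_law z) (\<lambda>y. exp (l * f y))
      = exp (l * (s * (corrector * centred z))) *
          measure_pmf.expectation (step_law z) (\<lambda>y. exp (l * (f y - s * (corrector * centred z))))"
      by (subst integral_mult_right_zero[symmetric]) (simp add: exp_add[symmetric] right_diff_distrib)
    ultimately show ?thesis
      by (simp add: f_def exp_add power_divide mult.commute)
  qed
  consider "\<theta> > 0" | "\<theta> = 0" | "\<theta> < 0" by linarith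
  then show ?thesis
  proof cases
    case 1
    from pos[OF this, of 1] show ?thesis by (simp add: one_plus_corrector)
  next
    case 3
    then have "- \<theta> > 0" by simp
    from pos[OF this, of "- 1"] show ?thesis by (simp add: one_plus_corrector)
  qed simp
qed

lemma integrable_word_law [simp]:
  fixes f :: "letter list \<Rightarrow> 'c::{banach, second_countable_topology}"
  shows "integrable (measure_pmf (word_law n z)) f"
  by (simp add: integrable_measure_pmf_finite)

lemma integrable_step_law [simp]:
  fixes f :: "letter \<Rightarrow> 'c::{banach, second_countable_topology}"
  shows "integrable (measure_pmf (step_law z)) f"
  by (simp add: integrable_measure_pmf_finite)

lemma abs_corrector_centred_le: "\<bar>\<theta> * (corrector * centred z)\<bar> \<le> \<bar>\<theta> * corrector\<bar>"
proof -
  have "\<bar>\<theta> * (corrector * centred z)\<bar> \<le> \<bar>\<theta> * corrector\<bar> * 1"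
    using abs_centred_le[of z] unfolding mult.assoc[symmetric] abs_mult[of "\<theta> * corrector"]
    by (intro mult_left_mono) auto
  then show ?thesis by simp
qed

lemma corrector_centred_nonneg: "0 \<le> \<theta> * (corrector * centred z) + \<bar>\<theta> * corrector\<bar>"
  and corrector_centred_le: "\<theta> * (corrector * centred z) \<le> \<bar>\<theta> * corrector\<bar>"
  using abs_corrector_centred_le[of \<theta> z] by linarith+

text \<open>The starting letter \<open>z\<close> appears in the bound through the corrector; in this form the inequality
  reproduces itself under one step, which a bound uniform in \<open>z\<close> would not.\<close>

lemma exp_centred_sum_bound_pointed:
  "measure_pmf.expectation (word_law n z) (\<lambda>w. exp (\<theta> * centred_sum w))
    \<le> exp (\<theta> * (corrector * centred z) + \<bar>\<theta> * corrector\<bar> + n * (\<theta>\<^sup>2 / (8 * (a + b)\<^sup>2)))"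
proof (induction n arbitrary: z)
  case 0
  show ?case using corrector_centred_nonneg[of \<theta> z] by simp
next
  case (Suc n)
  let ?K = "\<theta>\<^sup>2 / (8 * (a + b)\<^sup>2)"
  have "measure_pmf.expectation (word_law (Suc n) z) (\<lambda>w. exp (\<theta> * centred_sum w))
      = measure_pmf.expectation (step_law z) (\<lambda>y. exp (\<theta> * centred y) *
          measure_pmf.expectation (word_law n y) (\<lambda>w. exp (\<theta> * centred_sum w)))"
    by (simp add: expectation_word_law_Suc distrib_left exp_add del: word_law.simps)
  also have "\<dots> \<le> measure_pmf.expectation (step_law z) (\<lambda>y. exp (\<theta> * centred y) *
          exp (\<theta> * (corrector * centred y) + \<bar>\<theta> * corrector\<bar> + n * ?K))"
    by (intro integral_mono mult_left_mono Suc) auto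
  also have "\<dots> = exp (\<bar>\<theta> * corrector\<bar> + n * ?K) *
      measure_pmf.expectation (step_law z) (\<lambda>y. exp (\<theta> * ((1 + corrector) * centred y)))"
    by (subst integral_mult_right_zero[symmetric]) (simp add: exp_add[symmetric] algebra_simps)
  also have "\<dots> \<le> exp (\<bar>\<theta> * corrector\<bar> + n * ?K) * exp (\<theta> * (corrector * centred z) + ?K)"
    by (intro mult_left_mono exp_step) auto
  also have "\<dots> = exp (\<theta> * (corrector * centred z) + \<bar>\<theta> * corrector\<bar> + Suc n * ?K)"
    by (simp add: exp_add[symmetric] algebra_simps add_divide_distrib)
  finally show ?case .
qed

lemma exp_centred_sum_bound:
  "measure_pmf.expectation (word_law n z) (\<lambda>w. exp (\<theta> * centred_sum w))
    \<le> exp (2 * \<bar>\<theta> * corrector\<bar> + n * (\<theta>\<^sup>2 / (8 * (a + b)\<^sup>2)))"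
  by (rule order_trans[OF exp_centred_sum_bound_pointed]) (use corrector_centred_le[of \<theta> z] in simp)

text \<open>The maximum obeys the same bound that Markov's inequality gives for the end point alone. As \<open>walk_max\<close> exceeds a positive level \<open>l\<close>
  iff the walk after its first step exceeds the level seen from there, the exponential
  supermartingale bound propagates through the recursion on the first letter. For \<open>l \<le> 0\<close> the right
  side is at least 1.\<close>

lemma walk_max_tail_pointed:
  assumes "a = b" "0 \<le> \<theta>"
  shows "measure_pmf.prob (word_law n z) {w. l \<le> walk_max w}
    \<le> exp (\<theta> * (corrector * centred z) + \<bar>\<theta> * corrector\<bar> + n * (\<theta>\<^sup>2 / (8 * (a + b)\<^sup>2)) - \<theta> * (l / 2))"
proof (induction n arbitrary: z l)
  case 0
  show ?case
  proof (cases "l \<le> 0")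
    case True
    then have "\<theta> * l \<le> 0" using assms(2) by (simp add: mult_nonneg_nonpos)
    then show ?thesis using corrector_centred_nonneg[of \<theta> z] True
      by (auto intro!: order_trans[OF measure_pmf.prob_le_1])
  next
    case False
    then have "measure_pmf.prob (word_law 0 z) {w. l \<le> walk_max w} = 0"
      by (simp add: measure_return_pmf)
    then show ?thesis by simp
  qed
next
  case (Suc n)
  let ?K = "\<theta>\<^sup>2 / (8 * (a + b)\<^sup>2)"
  show ?case
  proof (cases "l \<le> 0")
    case True
    then have "\<theta> * (l / 2) \<le> 0" using assms(2) by (simp add: mult_nonneg_nonpos)
    moreover have "0 \<le> Suc n * ?K" by simp
    ultimately have "0 \<le> \<theta> * (corrector * centred z) + \<bar>\<theta> * corrector\<bar> + Suc n * ?K - \<theta> * (l / 2)"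
      using corrector_centred_nonneg[of \<theta> z] by linarith
    then show ?thesis
      by (intro order_trans[OF measure_pmf.prob_le_1]) (simp only: one_le_exp_iff)
  next
    case False
    have "measure_pmf.prob (word_law (Suc n) z) {w. l \<le> walk_max w}
        = measure_pmf.expectation (word_law (Suc n) z) (indicator {w. l \<le> walk_max w})"
      by simp
    also have "\<dots> = measure_pmf.expectation (step_law z) (\<lambda>y.
        measure_pmf.expectation (word_law n y) (indicator {w. l - step y \<le> walk_max w}))"
      unfolding expectation_word_law_Suc using False
      by (intro Bochner_Integration.integral_cong refl) (auto simp: indicator_def max_def)
    also have "\<dots> \<le> measure_pmf.expectation (step_law z) (\<lambda>y. exp (\<theta> * (corrector * centred y)
        + \<bar>\<theta> * corrector\<bar> + n * ?K - \<theta> * ((l - step y) / 2)))"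
      using Suc by (intro integral_mono) auto
    also have "\<dots> = exp (\<bar>\<theta> * corrector\<bar> + n * ?K - \<theta> * (l / 2)) *
      measure_pmf.expectation (step_law z) (\<lambda>y. exp (\<theta> * ((1 + corrector) * centred y)))"
      using assms(1) by (subst integral_mult_right_zero[symmetric])
        (simp add: exp_add[symmetric] step_eq_centred algebra_simps diff_divide_distrib)
    also have "\<dots> \<le> exp (\<bar>\<theta> * corrector\<bar> + n * ?K - \<theta> * (l / 2)) * exp (\<theta> * (corrector * centred z) + ?K)"
      by (intro mult_left_mono exp_step) auto
    also have "\<dots> = exp (\<theta> * (corrector * centred z) + \<bar>\<theta> * corrector\<bar> + Suc n * ?K - \<theta> * (l / 2))"
      by (simp add: exp_add[symmetric] algebra_simps add_divide_distrib)
    finally show ?thesis .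
  qed
qed

lemma walk_max_tail:
  assumes "a = b" "0 \<le> \<theta>"
  shows "measure_pmf.prob (word_law n z) {w. l \<le> walk_max w}
    \<le> exp (2 * \<bar>\<theta> * corrector\<bar> + n * (\<theta>\<^sup>2 / (8 * (a + b)\<^sup>2)) - \<theta> * (l / 2))"
  by (rule order_trans[OF walk_max_tail_pointed[OF assms]]) (use corrector_centred_le[of \<theta> z] in simp)

end

section \<open>Central limit theorem for the walk\<close>

lemma abs_exp_minus_linear_le:
  fixes s :: real
  assumes "0 \<le> s"
  shows "\<bar>exp (- s) - (1 - s)\<bar> \<le> s\<^sup>2 / 2"
proof -
  have "1 - s \<le> exp (- s)" using exp_ge_add_one_self[of "- s"] by simp
  moreover have "(\<lambda>x. exp (- x) - (1 - x + x\<^sup>2 / 2)) s \<le> (\<lambda>x. exp (- x) - (1 - x + x\<^sup>2 / 2)) 0"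
  proof (rule DERIV_nonpos_imp_nonincreasing[OF assms])
    fix x :: real assume "0 \<le> x"
    have "((\<lambda>x. exp (- x) - (1 - x + x\<^sup>2 / 2)) has_real_derivative - exp (- x) - (- 1 + x)) (at x)"
      by (auto intro!: derivative_eq_intros)
    moreover have "- exp (- x) - (- 1 + x) \<le> 0"
      using exp_ge_add_one_self[of "- x"] by simp
    ultimately show "\<exists>y. ((\<lambda>x. exp (- x) - (1 - x + x\<^sup>2 / 2)) has_real_derivative y) (at x) \<and> y \<le> 0"
      by blast
  qed
  ultimately show ?thesis by simp
qed

lemma norm_expectation_pmf_le:
  fixes f :: "'d \<Rightarrow> complex"
  assumes "\<And>y. norm (f y) \<le> B"
  shows "norm (measure_pmf.expectation p f) \<le> B"
proof -
  have "norm (measure_pmf.expectation p f) \<le> measure_pmf.expectation p (\<lambda>y. norm (f y))"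
    by (rule integral_norm_bound)
  also have "\<dots> \<le> measure_pmf.expectation p (\<lambda>y. B)"
    using assms by (intro integral_mono measure_pmf.integrable_const_bound[where B = B and f = "\<lambda>y. norm (f y)"]) auto
  finally show ?thesis by simp
qed

context mixing_chain
begin

text \<open>The variance \<open>a * b / (a + b)\<^sup>2\<close> of \<open>centred\<close> under the invariant law, times \<open>1 + 2 * corrector\<close> for the
  correlations in time.\<close>

definition asym_var :: real where
  "asym_var = a * b * (2 - a - b) / (a + b) ^ 3"

text \<open>Chosen so that the terms of order \<open>\<theta>\<^sup>2\<close> in the eigenvalue equation of \<open>eigenvector\<close> agree; the factor
  \<open>(a - b) / (a + b)\<close> is the coefficient of \<open>centred\<close> in \<open>centred\<^sup>2\<close>.\<close>

definition corrector2 :: real where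
  "corrector2 = - (1 / 2 + corrector) * ((a - b) / (a + b)) * corrector"

text \<open>The eigenfunction, to second order in \<open>\<theta>\<close>, of the operator \<open>h \<mapsto> P (exp (i \<theta> centred) * h)\<close>, where
  \<open>P\<close> is the transition operator. The \<open>n\<close>-th power of this operator maps 1 to the
  characteristic function of \<open>centred_sum\<close> on words of length \<open>n\<close>, as a function of the starting letter.\<close>

definition eigenvector :: "real \<Rightarrow> letter \<Rightarrow> complex" where
  "eigenvector \<theta> z = 1 + \<i> * of_real (\<theta> * corrector * centred z) + of_real (\<theta>\<^sup>2 * corrector2 * centred z)"

lemma asym_var_nonneg: "0 \<le> asym_var"
  using a01 b01 ab_pos by (simp add: asym_var_def)

lemma centred_square: "(centred z)\<^sup>2 = a * b / (a + b)\<^sup>2 + (a - b) / (a + b) * centred z"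
proof -
  have "a + b \<noteq> 0" using ab_pos by simp
  then show ?thesis
    by (cases z) (simp_all add: centred_def divide_simps power2_eq_square, simp_all add: algebra_simps)
qed

lemma step_law_linear:
  "measure_pmf.expectation (step_law z) (\<lambda>y. c + of_real (centred y) * d)
    = c + of_real ((1 - a - b) * centred z) * (d :: complex)"
proof -
  have "measure_pmf.expectation (step_law z) (\<lambda>y. complex_of_real (centred y)) = of_real ((1 - a - b) * centred z)"
    by (simp only: integral_complex_of_real step_law_centred)
  then show ?thesis by simp
qed

text \<open>The terms up to order \<open>\<theta>\<^sup>2\<close> of \<open>exp (i \<theta> centred) * eigenvector\<close>, averaged over one step. Since \<open>centred\<^sup>2\<close> is
  an affine function of \<open>centred\<close>, only the mean of \<open>centred\<close> enters.\<close>

lemma eigenvector_second_order: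
  "measure_pmf.expectation (step_law z) (\<lambda>y. 1 + \<i> * of_real (\<theta> * (1 + corrector) * centred y)
      + of_real (\<theta>\<^sup>2 * (corrector2 * centred y - (1 / 2 + corrector) * (centred y)\<^sup>2)))
    = eigenvector \<theta> z - of_real (asym_var * \<theta>\<^sup>2 / 2)"
proof -
  define \<rho> \<delta> q h where "\<rho> = 1 - a - b" and "\<delta> = (a - b) / (a + b)" and "q = a * b / (a + b)\<^sup>2"
    and "h = 1 / 2 + corrector"
  have ne: "a + b \<noteq> 0" using ab_pos by simp
  have r1: "(1 + corrector) * \<rho> = corrector" using ne by (simp add: corrector_def \<rho>_def divide_simps)
  have c2: "corrector2 = - h * \<delta> * corrector" by (simp add: corrector2_def h_def \<delta>_def)
  have hq: "h * q = asym_var / 2"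
    using ne by (simp add: h_def q_def asym_var_def corrector_def divide_simps power2_eq_square power3_eq_cube,
      simp add: algebra_simps)
  have "measure_pmf.expectation (step_law z) (\<lambda>y. 1 + \<i> * of_real (\<theta> * (1 + corrector) * centred y)
      + of_real (\<theta>\<^sup>2 * (corrector2 * centred y - h * (centred y)\<^sup>2)))
    = measure_pmf.expectation (step_law z) (\<lambda>y. (1 - of_real (\<theta>\<^sup>2 * h * q)) +
        of_real (centred y) * (\<i> * of_real (\<theta> * (1 + corrector)) + of_real (\<theta>\<^sup>2 * (corrector2 - h * \<delta>))))"
    by (intro Bochner_Integration.integral_cong refl)
       (simp add: centred_square \<delta>_def[symmetric] q_def[symmetric] algebra_simps)
  also have "\<dots> = (1 - of_real (\<theta>\<^sup>2 * h * q)) +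
        of_real (\<rho> * centred z) * (\<i> * of_real (\<theta> * (1 + corrector)) + of_real (\<theta>\<^sup>2 * (corrector2 - h * \<delta>)))"
    by (subst step_law_linear) (simp add: \<rho>_def)
  also have "\<dots> = 1 - of_real (\<theta>\<^sup>2 * (h * q)) + \<i> * of_real (\<theta> * ((1 + corrector) * \<rho>) * centred z)
      + of_real (\<theta>\<^sup>2 * (- h * \<delta> * ((1 + corrector) * \<rho>)) * centred z)"
    by (simp add: c2 algebra_simps)
  also have "\<dots> = eigenvector \<theta> z - of_real (asym_var * \<theta>\<^sup>2 / 2)"
    unfolding r1 hq by (simp add: eigenvector_def c2 algebra_simps)
  finally show ?thesis by (simp add: h_def)
qed

lemma eigenvector_near_one:
  assumes "\<bar>\<theta>\<bar> \<le> 1"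
  shows "norm (eigenvector \<theta> z - 1) \<le> \<bar>\<theta>\<bar> * (\<bar>corrector\<bar> + \<bar>corrector2\<bar>)"
proof -
  have "\<theta>\<^sup>2 \<le> \<bar>\<theta>\<bar>" using assms mult_left_mono[of "\<bar>\<theta>\<bar>" 1 "\<bar>\<theta>\<bar>"] by (simp add: power2_eq_square flip: abs_mult)
  have "norm (eigenvector \<theta> z - 1) \<le> norm (\<i> * complex_of_real (\<theta> * corrector * centred z)) + norm (complex_of_real (\<theta>\<^sup>2 * corrector2 * centred z))"
    unfolding eigenvector_def by (rule order_trans[OF _ norm_triangle_ineq]) simp
  also have "\<dots> = \<bar>\<theta>\<bar> * \<bar>corrector\<bar> * \<bar>centred z\<bar> + \<theta>\<^sup>2 * \<bar>corrector2\<bar> * \<bar>centred z\<bar>"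
    by (simp only: norm_mult norm_of_real norm_ii mult_1 abs_mult abs_power2)
  also have "\<dots> \<le> \<bar>\<theta>\<bar> * \<bar>corrector\<bar> * 1 + \<bar>\<theta>\<bar> * \<bar>corrector2\<bar> * 1"
    using abs_centred_le[of z] \<open>\<theta>\<^sup>2 \<le> \<bar>\<theta>\<bar>\<close> by (intro add_mono mult_mono) auto
  finally show ?thesis by (simp add: algebra_simps)
qed

definition eigen_defect :: "real \<Rightarrow> letter \<Rightarrow> real" where
  "eigen_defect \<theta> z =
     norm (measure_pmf.expectation (step_law z) (\<lambda>y. iexp (\<theta> * centred y) * eigenvector \<theta> y)
       - of_real (exp (- (asym_var * \<theta>\<^sup>2 / 2))) * eigenvector \<theta> z)"

text \<open>An error of order \<open>\<theta>\<^sup>3\<close> per step is affordable: with \<open>\<theta>\<close> of order \<open>1 / sqrt n\<close>, the errors of \<open>n\<close>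
  steps add up to order \<open>1 / sqrt n\<close>. Taking \<open>exp (- asym_var * \<theta>\<^sup>2 / 2)\<close> as the eigenvalue makes its
  powers exact Gaussian characteristic functions.\<close>

lemma approximate_eigenvector:
  "\<exists>K\<ge>0. \<forall>\<theta> z. \<bar>\<theta>\<bar> \<le> 1 \<longrightarrow> eigen_defect \<theta> z \<le> K * \<bar>\<theta>\<bar> ^ 3"
proof -
  define G H V where "G = \<bar>corrector\<bar>" and "H = \<bar>corrector2\<bar>" and "V = 1 + (G + H)"
  define K where "K = V / 6 + (G + 2 * H) + asym_var / 2 * (G + H) + asym_var\<^sup>2 / 8 * V"
  have K0: "0 \<le> K" using asym_var_nonneg by (simp add: K_def G_def H_def V_def)
  have GH: "0 \<le> G" "0 \<le> H" by (simp_all add: G_def H_def)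
  show ?thesis
  proof (intro exI[of _ K] conjI allI impI K0)
    fix \<theta> :: real and z
    assume \<theta>: "\<bar>\<theta>\<bar> \<le> 1"
    define s where "s = asym_var * \<theta>\<^sup>2 / 2"
    define A where "A y = 1 + \<i> * of_real (\<theta> * centred y) - of_real ((\<theta> * centred y)\<^sup>2 / 2)" for y
    define R where "R y = \<i> * of_real (corrector2 * (centred y)\<^sup>2) - \<i> * of_real (corrector * (centred y) ^ 3 / 2)
        - of_real (\<theta> * corrector2 * (centred y) ^ 3 / 2)" for y
    have s0: "0 \<le> s" using asym_var_nonneg by (simp add: s_def)
    have V0: "0 \<le> V" using GH by (simp add: V_def)
    have nv1: "norm (eigenvector \<theta> y - 1) \<le> \<bar>\<theta>\<bar> * (G + H)" for y
      using eigenvector_near_one[OF \<theta>] by (simp add: G_def H_def)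
    have nv: "norm (eigenvector \<theta> y) \<le> V" for y
    proof -
      have "norm (eigenvector \<theta> y) \<le> norm (eigenvector \<theta> y - 1) + norm (1 :: complex)"
        using norm_triangle_ineq[of "eigenvector \<theta> y - 1" 1] by simp
      moreover have "\<bar>\<theta>\<bar> * (G + H) \<le> 1 * (G + H)" using \<theta> GH by (intro mult_right_mono) auto
      ultimately show ?thesis using nv1[of y] by (simp add: V_def)
    qed
    have nr: "norm (iexp (\<theta> * centred y) - A y) \<le> \<bar>\<theta>\<bar> ^ 3 / 6" for y
    proof -
      have "norm (iexp (\<theta> * centred y) - A y) \<le> \<bar>\<theta> * centred y\<bar> ^ 3 / 6"
        using iexp_approx1[of "\<theta> * centred y" 2]
        by (simp add: A_def numeral_3_eq_3 numeral_2_eq_2 algebra_simps)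
      also have "\<dots> \<le> (\<bar>\<theta>\<bar> * 1) ^ 3 / 6"
        using abs_centred_le[of y] unfolding abs_mult
        by (intro divide_right_mono power_mono mult_left_mono) auto
      finally show ?thesis by simp
    qed
    have nR: "norm (R y) \<le> G + 2 * H" for y
    proof -
      have c2: "\<bar>centred y\<bar>\<^sup>2 \<le> 1" and c3: "\<bar>centred y\<bar> ^ 3 \<le> 1"
        by (rule power_le_one[OF abs_ge_zero abs_centred_le])+
      have "norm (R y) \<le> norm (\<i> * complex_of_real (corrector2 * (centred y)\<^sup>2)) + norm (\<i> * complex_of_real (corrector * (centred y) ^ 3 / 2))
        + norm (complex_of_real (\<theta> * corrector2 * (centred y) ^ 3 / 2))"
        unfolding R_def by (intro order_trans[OF norm_triangle_ineq4] add_mono order_refl)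
      also have "\<dots> = H * \<bar>centred y\<bar>\<^sup>2 + G / 2 * \<bar>centred y\<bar> ^ 3 + \<bar>\<theta>\<bar> * (H / 2) * \<bar>centred y\<bar> ^ 3"
        by (simp add: norm_mult abs_mult power_abs G_def H_def del: of_real_mult of_real_divide of_real_power)
      also have "\<dots> \<le> H * 1 + G / 2 * 1 + 1 * (H / 2) * 1"
        by (intro add_mono mult_mono c2 c3 GH \<theta> order_refl mult_nonneg_nonneg) (use GH in simp_all)
      finally show ?thesis using GH by simp
    qed
    have expand: "A y * eigenvector \<theta> y = (1 + \<i> * of_real (\<theta> * (1 + corrector) * centred y)
        + of_real (\<theta>\<^sup>2 * (corrector2 * centred y - (1 / 2 + corrector) * (centred y)\<^sup>2))) + of_real (\<theta> ^ 3) * R y" for y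
      unfolding complex_eq_iff A_def R_def eigenvector_def
      by (simp del: of_real_mult of_real_divide of_real_power of_real_diff of_real_add)
         (simp add: algebra_simps power2_eq_square power3_eq_cube)
    have "measure_pmf.expectation (step_law z) (\<lambda>y. iexp (\<theta> * centred y) * eigenvector \<theta> y)
      = measure_pmf.expectation (step_law z) (\<lambda>y. A y * eigenvector \<theta> y)
        + measure_pmf.expectation (step_law z) (\<lambda>y. (iexp (\<theta> * centred y) - A y) * eigenvector \<theta> y)"
      by (subst Bochner_Integration.integral_add[symmetric]) (auto simp: algebra_simps)
    also have "measure_pmf.expectation (step_law z) (\<lambda>y. A y * eigenvector \<theta> y)
        = eigenvector \<theta> z - of_real s + of_real (\<theta> ^ 3) * measure_pmf.expectation (step_law z) R"
      unfolding expand s_def using eigenvector_second_order[of z \<theta>]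
      by (subst Bochner_Integration.integral_add) auto
    finally have eq: "measure_pmf.expectation (step_law z) (\<lambda>y. iexp (\<theta> * centred y) * eigenvector \<theta> y)
        - of_real (exp (- s)) * eigenvector \<theta> z
      = measure_pmf.expectation (step_law z) (\<lambda>y. (iexp (\<theta> * centred y) - A y) * eigenvector \<theta> y)
        + of_real (\<theta> ^ 3) * measure_pmf.expectation (step_law z) R
        + of_real s * (eigenvector \<theta> z - 1) - of_real (exp (- s) - (1 - s)) * eigenvector \<theta> z"
      by (simp add: algebra_simps)
    have t1: "norm (measure_pmf.expectation (step_law z) (\<lambda>y. (iexp (\<theta> * centred y) - A y) * eigenvector \<theta> y))
        \<le> \<bar>\<theta>\<bar> ^ 3 / 6 * V"
      by (rule norm_expectation_pmf_le, unfold norm_mult, rule mult_mono[OF nr nv]) simp_all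
    have t2: "norm (of_real (\<theta> ^ 3) * measure_pmf.expectation (step_law z) R) \<le> \<bar>\<theta>\<bar> ^ 3 * (G + 2 * H)"
      using norm_expectation_pmf_le[of R, OF nR]
      by (auto simp: norm_mult norm_power intro!: mult_left_mono)
    have t3: "norm (of_real s * (eigenvector \<theta> z - 1)) \<le> \<bar>\<theta>\<bar> ^ 3 * (asym_var / 2 * (G + H))"
    proof -
      have "norm (of_real s * (eigenvector \<theta> z - 1)) \<le> s * (\<bar>\<theta>\<bar> * (G + H))"
        using nv1[of z] s0 by (auto simp: norm_mult intro!: mult_left_mono)
      also have "\<dots> = \<bar>\<theta>\<bar> ^ 3 * (asym_var / 2 * (G + H))"
        by (simp add: s_def power3_eq_cube power2_eq_square)
      finally show ?thesis .
    qed
    have t4: "norm (of_real (exp (- s) - (1 - s)) * eigenvector \<theta> z) \<le> \<bar>\<theta>\<bar> ^ 3 * (asym_var\<^sup>2 / 8 * V)"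
    proof -
      have "norm (of_real (exp (- s) - (1 - s)) * eigenvector \<theta> z) \<le> (s\<^sup>2 / 2) * V"
        using abs_exp_minus_linear_le[OF s0] nv[of z] unfolding norm_mult norm_of_real
        by (intro mult_mono) auto
      also have "s\<^sup>2 / 2 = \<bar>\<theta>\<bar> ^ 4 * (asym_var\<^sup>2 / 8)"
        by (simp add: s_def power_divide power_mult_distrib)
      also have "\<dots> * V \<le> \<bar>\<theta>\<bar> ^ 3 * (asym_var\<^sup>2 / 8) * V"
        using \<theta> V0 by (intro mult_right_mono power_decreasing) auto
      also have "\<bar>\<theta>\<bar> ^ 3 * (asym_var\<^sup>2 / 8) * V = \<bar>\<theta>\<bar> ^ 3 * (asym_var\<^sup>2 / 8 * V)"
        by (simp only: mult.assoc)
      finally show ?thesis .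
    qed
    have "norm (measure_pmf.expectation (step_law z) (\<lambda>y. iexp (\<theta> * centred y) * eigenvector \<theta> y)
        - of_real (exp (- s)) * eigenvector \<theta> z)
      \<le> \<bar>\<theta>\<bar> ^ 3 / 6 * V + \<bar>\<theta>\<bar> ^ 3 * (G + 2 * H) + \<bar>\<theta>\<bar> ^ 3 * (asym_var / 2 * (G + H)) + \<bar>\<theta>\<bar> ^ 3 * (asym_var\<^sup>2 / 8 * V)"
      unfolding eq
      by (intro order_trans[OF norm_triangle_ineq4] order_trans[OF norm_triangle_ineq] add_mono t1 t2 t3 t4)
    also have "\<dots> = K * \<bar>\<theta>\<bar> ^ 3" by (simp add: K_def algebra_simps)
    finally show "eigen_defect \<theta> z \<le> K * \<bar>\<theta>\<bar> ^ 3"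
      by (simp add: s_def eigen_defect_def)
  qed
qed

text \<open>The central limit theorem for a general array of lengths \<open>N k\<close> and scales \<open>\<theta> k\<close>: the whole word is
  the case \<open>N n = n\<close>, \<open>\<theta> n = u / sqrt n\<close>, and blocks of a fixed proportion of the word need the
  other cases. The limit does not depend on the starting letter.\<close>

theorem char_centred_sum_tendsto:
  fixes N :: "nat \<Rightarrow> nat" and \<theta> :: "nat \<Rightarrow> real" and t :: real
  assumes \<theta>: "\<theta> \<longlonglongrightarrow> 0" and N: "(\<lambda>k. N k * (\<theta> k)\<^sup>2) \<longlonglongrightarrow> t"
  shows "(\<lambda>k. measure_pmf.expectation (word_law (N k) z) (\<lambda>w. iexp (\<theta> k * centred_sum w)))
    \<longlonglongrightarrow> of_real (exp (- (asym_var * t / 2)))"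
proof -
  obtain K where K: "0 \<le> K" "\<forall>\<theta> z. \<bar>\<theta>\<bar> \<le> 1 \<longrightarrow> eigen_defect \<theta> z \<le> K * \<bar>\<theta>\<bar> ^ 3"
    using approximate_eigenvector by blast
  define L where "L \<theta> = exp (- (asym_var * \<theta>\<^sup>2 / 2))" for \<theta> :: real
  have L: "0 \<le> L \<theta>" "L \<theta> \<le> 1" for \<theta> using asym_var_nonneg by (simp_all add: L_def)
  \<comment> \<open>Each step multiplies by at most 1 in modulus, so the one-step defects add up.\<close>
  have iter: "norm (measure_pmf.expectation (word_law n z) (\<lambda>w. iexp (\<theta> * centred_sum w) * eigenvector \<theta> (last (z # w)))
      - of_real (L \<theta> ^ n) * eigenvector \<theta> z) \<le> n * (K * \<bar>\<theta>\<bar> ^ 3)"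
    if "\<bar>\<theta>\<bar> \<le> 1" for \<theta> n z
  proof (induction n arbitrary: z)
    case (Suc n)
    let ?D = "\<lambda>y. measure_pmf.expectation (word_law n y) (\<lambda>w. iexp (\<theta> * centred_sum w) * eigenvector \<theta> (last (y # w)))"
    have "measure_pmf.expectation (word_law (Suc n) z) (\<lambda>w. iexp (\<theta> * centred_sum w) * eigenvector \<theta> (last (z # w)))
      = measure_pmf.expectation (step_law z) (\<lambda>y. iexp (\<theta> * centred y) * ?D y)"
      unfolding expectation_word_law_Suc integral_mult_right_zero[symmetric]
      by (intro Bochner_Integration.integral_cong refl)
         (simp add: distrib_left exp_add mult.assoc)
    also have "\<dots> = measure_pmf.expectation (step_law z)
            (\<lambda>y. iexp (\<theta> * centred y) * (?D y - of_real (L \<theta> ^ n) * eigenvector \<theta> y))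
        + of_real (L \<theta> ^ n) * measure_pmf.expectation (step_law z) (\<lambda>y. iexp (\<theta> * centred y) * eigenvector \<theta> y)"
      unfolding expectation_letter by (simp add: scaleR_conv_of_real algebra_simps)
    finally have "measure_pmf.expectation (word_law (Suc n) z) (\<lambda>w. iexp (\<theta> * centred_sum w) * eigenvector \<theta> (last (z # w)))
        - of_real (L \<theta> ^ Suc n) * eigenvector \<theta> z
      = measure_pmf.expectation (step_law z)
            (\<lambda>y. iexp (\<theta> * centred y) * (?D y - of_real (L \<theta> ^ n) * eigenvector \<theta> y))
        + of_real (L \<theta> ^ n) * (measure_pmf.expectation (step_law z) (\<lambda>y. iexp (\<theta> * centred y) * eigenvector \<theta> y)
            - of_real (L \<theta>) * eigenvector \<theta> z)"
      by (simp add: algebra_simps)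
    also have "norm \<dots> \<le> n * (K * \<bar>\<theta>\<bar> ^ 3) + K * \<bar>\<theta>\<bar> ^ 3"
    proof (intro order_trans[OF norm_triangle_ineq] add_mono)
      show "norm (measure_pmf.expectation (step_law z)
            (\<lambda>y. iexp (\<theta> * centred y) * (?D y - of_real (L \<theta> ^ n) * eigenvector \<theta> y))) \<le> n * (K * \<bar>\<theta>\<bar> ^ 3)"
        using Suc by (intro norm_expectation_pmf_le) (simp only: norm_mult norm_exp_i_times mult_1)
      have "norm (complex_of_real (L \<theta> ^ n)) \<le> 1" using L[of \<theta>] by (simp add: norm_power power_le_one)
      then have "norm (of_real (L \<theta> ^ n) * (measure_pmf.expectation (step_law z) (\<lambda>y. iexp (\<theta> * centred y) * eigenvector \<theta> y)
            - of_real (L \<theta>) * eigenvector \<theta> z)) \<le> 1 * (K * \<bar>\<theta>\<bar> ^ 3)"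
        unfolding norm_mult using K(2)[rule_format, OF that, of z] by (intro mult_mono) (simp_all add: L_def eigen_defect_def)
      then show "norm (of_real (L \<theta> ^ n) * (measure_pmf.expectation (step_law z) (\<lambda>y. iexp (\<theta> * centred y) * eigenvector \<theta> y)
            - of_real (L \<theta>) * eigenvector \<theta> z)) \<le> K * \<bar>\<theta>\<bar> ^ 3" by simp
    qed
    also have "\<dots> = Suc n * (K * \<bar>\<theta>\<bar> ^ 3)" by (simp add: algebra_simps)
    finally show ?case .
  qed simp
  let ?g = "\<bar>corrector\<bar> + \<bar>corrector2\<bar>"
  \<comment> \<open>Replacing the approximate eigenvector by 1 at both ends costs a multiple of the scale.\<close>
  have close: "norm (measure_pmf.expectation (word_law n z) (\<lambda>w. iexp (\<theta> * centred_sum w)) - of_real (L \<theta> ^ n))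
      \<le> 2 * (\<bar>\<theta>\<bar> * ?g) + n * (K * \<bar>\<theta>\<bar> ^ 3)" if t: "\<bar>\<theta>\<bar> \<le> 1" for \<theta> n
  proof -
    let ?E = "measure_pmf.expectation (word_law n z)"
    have "?E (\<lambda>w. iexp (\<theta> * centred_sum w)) - of_real (L \<theta> ^ n)
      = (?E (\<lambda>w. iexp (\<theta> * centred_sum w) * eigenvector \<theta> (last (z # w))) - of_real (L \<theta> ^ n) * eigenvector \<theta> z)
        - ?E (\<lambda>w. iexp (\<theta> * centred_sum w) * (eigenvector \<theta> (last (z # w)) - 1))
        + of_real (L \<theta> ^ n) * (eigenvector \<theta> z - 1)"
      by (simp add: right_diff_distrib)
    also have "norm \<dots> \<le> n * (K * \<bar>\<theta>\<bar> ^ 3) + \<bar>\<theta>\<bar> * ?g + 1 * (\<bar>\<theta>\<bar> * ?g)"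
    proof (rule order_trans[OF norm_triangle_ineq], rule add_mono,
        rule order_trans[OF norm_triangle_ineq4], rule add_mono)
      show "norm (?E (\<lambda>w. iexp (\<theta> * centred_sum w) * (eigenvector \<theta> (last (z # w)) - 1))) \<le> \<bar>\<theta>\<bar> * ?g"
        using eigenvector_near_one[OF t] by (intro norm_expectation_pmf_le) (simp only: norm_mult norm_exp_i_times mult_1)
      show "norm (of_real (L \<theta> ^ n) * (eigenvector \<theta> z - 1)) \<le> 1 * (\<bar>\<theta>\<bar> * ?g)"
        unfolding norm_mult using L[of \<theta>] eigenvector_near_one[OF t, of z]
        by (intro mult_mono) (simp_all add: norm_power power_le_one)
    qed (rule iter[OF t])
    finally show ?thesis by simp
  qed
  have ev: "eventually (\<lambda>k. \<bar>\<theta> k\<bar> \<le> 1) sequentially"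
    using order_tendstoD(2)[OF tendsto_rabs[OF \<theta>], of 1] by (simp add: eventually_mono)
  have err: "(\<lambda>k. 2 * (\<bar>\<theta> k\<bar> * ?g) + N k * (K * \<bar>\<theta> k\<bar> ^ 3)) \<longlonglongrightarrow> 0"
  proof -
    have "(\<lambda>k. 2 * (\<bar>\<theta> k\<bar> * ?g) + (N k * (\<theta> k)\<^sup>2) * (K * \<bar>\<theta> k\<bar>)) \<longlonglongrightarrow> 2 * (\<bar>0\<bar> * ?g) + t * (K * \<bar>0\<bar>)"
      by (intro tendsto_intros \<theta> N)
    moreover have "(\<lambda>k. 2 * (\<bar>\<theta> k\<bar> * ?g) + N k * (K * \<bar>\<theta> k\<bar> ^ 3))
        = (\<lambda>k. 2 * (\<bar>\<theta> k\<bar> * ?g) + (N k * (\<theta> k)\<^sup>2) * (K * \<bar>\<theta> k\<bar>))"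
      by (intro ext) (simp add: power3_eq_cube power2_eq_square)
    ultimately show ?thesis by simp
  qed
  have "(\<lambda>k. measure_pmf.expectation (word_law (N k) z) (\<lambda>w. iexp (\<theta> k * centred_sum w)) - of_real (L (\<theta> k) ^ N k)) \<longlonglongrightarrow> 0"
    by (rule Lim_null_comparison[OF _ err]) (use ev in \<open>eventually_elim, use close in blast\<close>)
  moreover have "(\<lambda>k. complex_of_real (L (\<theta> k) ^ N k)) \<longlonglongrightarrow> of_real (exp (- (asym_var * t / 2)))"
  proof -
    have "(\<lambda>k. exp (- (asym_var * (N k * (\<theta> k)\<^sup>2) / 2))) \<longlonglongrightarrow> exp (- (asym_var * t / 2))"
      by (intro tendsto_intros N) simp
    moreover have "L (\<theta> k) ^ N k = exp (- (asym_var * (N k * (\<theta> k)\<^sup>2) / 2))" for k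
      by (simp add: L_def exp_of_nat_mult[symmetric])
    ultimately show ?thesis by (intro tendsto_of_real) simp
  qed
  ultimately show ?thesis
    using tendsto_add by fastforce
qed

end

section \<open>Normal laws and weak convergence on the antidiagonal\<close>

lemma normal_law_eq_distr:
  assumes "0 \<le> v"
  shows "normal_law 0 v = distr std_normal_distribution borel (\<lambda>x. sqrt v * x)"
proof (cases "v = 0")
  case True
  interpret prob_space std_normal_distribution
    using prob_space_normal_density[of 1 0] by simp
  show ?thesis using True by (simp add: normal_law_def distr_const)
next
  case False
  then have v: "0 < sqrt v" using assms by simp
  interpret S: prob_space std_normal_distribution
    using prob_space_normal_density[of 1 0] by simp
  have "distributed std_normal_distribution lborel (\<lambda>x. x) (normal_density 0 1)"
    unfolding distributed_def by (auto simp: distr_id2)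
  from S.normal_density_affine[OF this _ , of "sqrt v" 0] v
  have "distributed std_normal_distribution lborel (\<lambda>x. sqrt v * x) (normal_density 0 (sqrt v))"
    by simp
  from distributed_distr_eq_density[OF this] False show ?thesis
    by (simp add: normal_law_def cong: distr_cong)
qed

lemma real_distribution_normal_law [simp]:
  assumes "0 \<le> v"
  shows "real_distribution (normal_law 0 v)"
proof -
  interpret S: prob_space std_normal_distribution
    using prob_space_normal_density[of 1 0] by simp
  show ?thesis unfolding normal_law_eq_distr[OF assms]
    by (rule S.real_distribution_distr) simp
qed

lemma char_distr:
  assumes "f \<in> borel_measurable M"
  shows "char (distr M borel f) t = (CLINT x|M. iexp (t * f x))"
  using assms unfolding char_def by (subst integral_distr) auto

lemma char_normal_law:
  assumes "0 \<le> v"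
  shows "char (normal_law 0 v) t = of_real (exp (- (v * t\<^sup>2 / 2)))"
proof -
  have "char (normal_law 0 v) t = char std_normal_distribution (t * sqrt v)"
    unfolding normal_law_eq_distr[OF assms] by (subst char_distr) (simp_all add: char_def mult.assoc)
  then show ?thesis using assms by (simp add: char_std_normal_distribution power_mult_distrib mult.commute)
qed

lemma distr_scale_normal_law:
  assumes "0 \<le> v"
  shows "distr (normal_law 0 v) borel (\<lambda>x. c * x) = normal_law 0 (c\<^sup>2 * v)"
proof (rule Levy_uniqueness)
  interpret V: real_distribution "normal_law 0 v" using assms by simp
  show "real_distribution (distr (normal_law 0 v) borel (\<lambda>x. c * x))"
    by (rule V.real_distribution_distr) simp
  show "real_distribution (normal_law 0 (c\<^sup>2 * v))" using assms by simp
  show "char (distr (normal_law 0 v) borel (\<lambda>x. c * x)) = char (normal_law 0 (c\<^sup>2 * v))"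
  proof
    fix t
    have "char (distr (normal_law 0 v) borel (\<lambda>x. c * x)) t = char (normal_law 0 v) (t * c)"
      by (subst char_distr) (simp_all add: char_def mult.assoc)
    then show "char (distr (normal_law 0 v) borel (\<lambda>x. c * x)) t = char (normal_law 0 (c\<^sup>2 * v)) t"
      using assms by (simp add: char_normal_law power_mult_distrib mult_ac)
  qed
qed

definition antidiag :: "real \<Rightarrow> real ^ 2" where
  "antidiag x = vector [x, - x]"

lemma antidiag_nth [simp]: "antidiag x $ 1 = x" "antidiag x $ 2 = - x"
  by (simp_all add: antidiag_def)

lemma continuous_on_antidiag: "continuous_on S antidiag"
proof -
  have "antidiag = (\<lambda>x. x *\<^sub>R antidiag 1)"
    by (simp add: fun_eq_iff vec_eq_iff forall_2)
  moreover have "continuous_on S (\<lambda>x. x *\<^sub>R antidiag 1)"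
    by (intro continuous_intros)
  ultimately show ?thesis by (rule ssubst[where P = "continuous_on S"])
qed

lemma measurable_antidiag [measurable]: "antidiag \<in> borel_measurable borel"
  by (rule borel_measurable_continuous_onI[OF continuous_on_antidiag])

text \<open>Both coordinates are images of one real random variable under a continuous map, so Levy's continuity
  theorem on the real line suffices for the convergence of the joint law.\<close>

lemma weakly_converges_antidiag:
  assumes M: "prob_space M" and Y [measurable]: "\<And>n. Y n \<in> borel_measurable M"
    and \<nu>: "real_distribution \<nu>"
    and char: "\<And>u. (\<lambda>n. CLINT \<omega>|M. iexp (u * Y n \<omega>)) \<longlonglongrightarrow> char \<nu> u"
  shows "weakly_converges (\<lambda>n. distr M borel (\<lambda>\<omega>. antidiag (Y n \<omega>))) (distr \<nu> borel antidiag)"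
  unfolding weakly_converges_def
proof (intro allI impI, elim conjE)
  interpret prob_space M by fact
  interpret \<nu>: real_distribution \<nu> by fact
  fix f :: "real ^ 2 \<Rightarrow> real"
  assume cont: "continuous_on UNIV f" and bdd: "bounded (range f)"
  have [measurable]: "f \<in> borel_measurable borel"
    using cont by (rule borel_measurable_continuous_onI)
  have rd: "real_distribution (distr M borel (Y n))" for n
    by (rule real_distribution_distr) simp
  have wc: "weak_conv_m (\<lambda>n. distr M borel (Y n)) \<nu>"
    using char by (intro levy_continuity rd \<nu>) (simp add: char_distr)
  obtain C where C: "\<And>x. norm (f x) \<le> C" using bdd by (auto simp: bounded_iff)
  have "continuous_on UNIV (\<lambda>x. f (antidiag x))"
    by (rule continuous_on_compose2[OF cont continuous_on_antidiag]) auto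
  then have "isCont (\<lambda>x. f (antidiag x)) x" for x
    by (simp add: continuous_on_eq_continuous_at)
  from weak_conv_imp_integral_bdd_continuous_conv[OF rd \<nu> wc this C]
  have "(\<lambda>n. integral\<^sup>L (distr M borel (Y n)) (\<lambda>x. f (antidiag x))) \<longlonglongrightarrow> integral\<^sup>L \<nu> (\<lambda>x. f (antidiag x))" .
  then show "(\<lambda>n. integral\<^sup>L (distr M borel (\<lambda>\<omega>. antidiag (Y n \<omega>))) f) \<longlonglongrightarrow> integral\<^sup>L (distr \<nu> borel antidiag) f"
    by (simp add: integral_distr)
qed

text \<open>The two rows add up to \<open>n\<close> and the centrings to 1, hence the second coordinate is the negative of
  the first. It is enough to treat each possible starting letter separately because the limit is the
  same for all of them.\<close>

lemma weak_limit_of_word_law: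
  fixes c d :: real
  assumes mc: "markov_chain M X (init_prob a b) (trans_prob a b)"
    and ch: "two_letter_chain a b" and \<nu>: "real_distribution \<nu>"
    and char: "\<And>u z. init_prob a b z \<noteq> 0 \<Longrightarrow>
      (\<lambda>n. measure_pmf.expectation (two_letter_chain.word_law a b n z)
         (\<lambda>w. iexp (u * ((top_row w - n * c) / sqrt n)))) \<longlonglongrightarrow> char \<nu> u"
    and cd: "c + d = 1"
  shows "weakly_converges
       (\<lambda>n. distr M borel (\<lambda>\<omega>. vector
          [(real (row_len X 1 n \<omega>) - real n * c) / sqrt (real n),
           (real (row_len X 2 n \<omega>) - real n * d) / sqrt (real n)])) (distr \<nu> borel antidiag)"
proof -
  interpret two_letter_chain a b by fact
  have ps: "prob_space M" using mc by (simp add: markov_chain_def)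
  let ?W = "\<lambda>n \<omega>. map (\<lambda>k. X k \<omega>) [1..<Suc n]"
  define Y where "Y n \<omega> = (top_row (?W n \<omega>) - n * c) / sqrt n" for n \<omega>
  have meas [measurable]: "?W n \<in> measurable M (count_space UNIV)" for n
    by (rule markov_chain_word_law(1)[OF mc ch])
  have Ymeas: "Y n \<in> borel_measurable M" for n
    unfolding Y_def by (rule measurable_compose[OF meas]) simp
  have eq: "vector [(real (row_len X 1 n \<omega>) - real n * c) / sqrt (real n),
           (real (row_len X 2 n \<omega>) - real n * d) / sqrt (real n)] = antidiag (Y n \<omega>)" for n \<omega>
  proof -
    have d: "d = 1 - c" using cd by simp
    have "(real (row_len X 2 n \<omega>) - real n * d) / sqrt (real n) = - Y n \<omega>"
      by (simp add: row_len_def rsk_row_lengths Y_def d minus_divide_left algebra_simps del: upt_Suc)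
    moreover have "(real (row_len X 1 n \<omega>) - real n * c) / sqrt (real n) = Y n \<omega>"
      unfolding row_len_def rsk_row_lengths Y_def ..
    ultimately show ?thesis by (simp add: antidiag_def)
  qed
  show ?thesis unfolding eq
  proof (rule weakly_converges_antidiag[OF ps Ymeas \<nu>])
    fix u
    have each: "(\<lambda>n. pmf init_law z *\<^sub>R measure_pmf.expectation (word_law n z)
        (\<lambda>w. iexp (u * ((top_row w - n * c) / sqrt n)))) \<longlonglongrightarrow> pmf init_law z *\<^sub>R char \<nu> u" for z
      using char[of z u] by (cases "init_prob a b z = 0") (simp_all add: tendsto_scaleR)
    have "(\<lambda>n. measure_pmf.expectation init_law (\<lambda>z. measure_pmf.expectation (word_law n z)
        (\<lambda>w. iexp (u * ((top_row w - n * c) / sqrt n))))) \<longlonglongrightarrow> measure_pmf.expectation init_law (\<lambda>z. char \<nu> u)"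
      unfolding expectation_letter by (intro tendsto_add each)
    then have fin: "(\<lambda>n. measure_pmf.expectation init_law (\<lambda>z. measure_pmf.expectation (word_law n z)
        (\<lambda>w. iexp (u * ((top_row w - n * c) / sqrt n))))) \<longlonglongrightarrow> char \<nu> u"
      by simp
    have "(CLINT \<omega>|M. iexp (u * Y n \<omega>)) = measure_pmf.expectation init_law (\<lambda>z. measure_pmf.expectation (word_law n z)
        (\<lambda>w. iexp (u * ((top_row w - n * c) / sqrt n))))" for n
    proof -
      have "(CLINT \<omega>|M. iexp (u * Y n \<omega>)) = (CLINT w|distr M (count_space UNIV) (?W n).
          iexp (u * ((top_row w - n * c) / sqrt n)))"
        unfolding Y_def by (subst integral_distr[OF meas]) simp_all
      then show ?thesis unfolding markov_chain_word_law(2)[OF mc ch]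
        by (simp only: expectation_chain_law)
    qed
    with fin show "(\<lambda>n. CLINT \<omega>|M. iexp (u * Y n \<omega>)) \<longlonglongrightarrow> char \<nu> u" by (simp only:)
  qed
qed

lemma multivariate_normal_antidiag:
  assumes v: "0 \<le> v"
  shows "multivariate_normal (distr (normal_law 0 v) borel antidiag) 0
    (v *\<^sub>R (vector [vector [1, -1], vector [-1, 1]] :: real ^ 2 ^ 2))"
proof -
  interpret V: real_distribution "normal_law 0 v" using v by simp
  let ?S = "v *\<^sub>R (vector [vector [1, -1], vector [-1, 1]] :: real ^ 2 ^ 2)"
  have q: "u \<bullet> (?S *v u) = (u $ 1 - u $ 2)\<^sup>2 * v" for u
    by (simp add: inner_vec_def matrix_vector_mult_def sum_2 power2_eq_square algebra_simps)
  have lin: "u \<bullet> antidiag x = (u $ 1 - u $ 2) * x" for u x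
    by (simp add: inner_vec_def sum_2 algebra_simps)
  show ?thesis unfolding multivariate_normal_def q
  proof (intro conjI allI)
    show "prob_space (distr (normal_law 0 v) borel antidiag)"
      by (rule V.prob_space_distr) simp
    show "transpose ?S = ?S"
      by (simp add: transpose_def vec_eq_iff forall_2)
    show "distr (distr (normal_law 0 v) borel antidiag) borel (\<lambda>x. u \<bullet> x)
        = normal_law (u \<bullet> 0) ((u $ 1 - u $ 2)\<^sup>2 * v)" for u
      by (subst distr_distr) (simp_all add: o_def lin distr_scale_normal_law[OF v])
  qed (use v in simp_all)
qed

lemma norm_iexp_diff_le: "norm (iexp x - iexp y) \<le> \<bar>x - y\<bar>"
proof -
  have "iexp x - iexp y = iexp y * (iexp (x - y) - 1)"
    by (simp add: right_diff_distrib flip: exp_add)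
  then have "norm (iexp x - iexp y) = norm (iexp (x - y) - 1)"
    by (simp add: norm_mult)
  also have "\<dots> \<le> \<bar>x - y\<bar>" using iexp_approx1[of "x - y" 0] by simp
  finally show ?thesis .
qed

section \<open>Biased chains: the maximum is negligible\<close>

context mixing_chain
begin

text \<open>An exponential moment growing linearly in \<open>n\<close> still forces a mean of order \<open>ln n\<close>, which is
  negligible against \<open>sqrt n\<close>. This tolerates the union bound over the \<open>n + 1\<close> times at which a
  maximum can be attained.\<close>

lemma expectation_from_exp_moment:
  fixes f :: "letter list \<Rightarrow> real" and C :: real
  assumes "0 < \<theta>" and exp: "measure_pmf.expectation (word_law n z) (\<lambda>w. exp (\<theta> * f w)) \<le> Suc n * C"
  shows "measure_pmf.expectation (word_law n z) f \<le> (ln (Suc n) + C) / \<theta>"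
proof -
  \<comment> \<open>Convexity of exp in the form \<open>y \<le> exp y\<close>, applied to \<open>\<theta> * f w\<close> shifted by \<open>ln (n + 1)\<close>.\<close>
  let ?A = "ln (real (Suc n))"
  have "f w \<le> ?A / \<theta> + exp (\<theta> * f w) * (1 / (\<theta> * Suc n))" for w
  proof -
    have "\<theta> * f w - ?A \<le> exp (\<theta> * f w - ?A)" using exp_ge_add_one_self[of "\<theta> * f w - ?A"] by linarith
    also have "\<dots> = exp (\<theta> * f w) / Suc n" by (simp add: exp_diff)
    finally have "\<theta> * f w \<le> ?A + exp (\<theta> * f w) / Suc n" by simp
    then have "f w \<le> (?A + exp (\<theta> * f w) / Suc n) / \<theta>" using assms(1) by (simp add: pos_le_divide_eq mult.commute)
    then show ?thesis by (simp add: add_divide_distrib mult.commute)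
  qed
  then have "measure_pmf.expectation (word_law n z) f
      \<le> measure_pmf.expectation (word_law n z) (\<lambda>w. ?A / \<theta> + exp (\<theta> * f w) * (1 / (\<theta> * Suc n)))"
    by (intro integral_mono) auto
  also have "\<dots> = ?A / \<theta> + measure_pmf.expectation (word_law n z) (\<lambda>w. exp (\<theta> * f w)) * (1 / (\<theta> * Suc n))"
    by (subst Bochner_Integration.integral_add) auto
  also have "\<dots> \<le> ?A / \<theta> + (Suc n * C) * (1 / (\<theta> * Suc n))"
    using assms by (intro add_left_mono mult_right_mono exp) auto
  also have "\<dots> = (?A + C) / \<theta>" by (simp add: add_divide_distrib)
  finally show ?thesis .
qed

text \<open>If \<open>Alpha2\<close> is the more frequent letter, the walk drifts down and its maximum stays bounded in
  probability. The exponent \<open>\<theta>\<close> is the one at which the drift exactly compensates the quadratic term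
  of \<open>exp_step\<close>, so that each step adds at most the bound for the empty word.\<close>

lemma exp_walk_max_bound:
  assumes "b < a"
  defines "\<theta> \<equiv> 2 * ((a - b) / (a + b)) * (a + b)\<^sup>2"
  shows "measure_pmf.expectation (word_law n z) (\<lambda>w. exp (\<theta> * walk_max w))
    \<le> Suc n * exp (2 * \<theta> * (corrector * centred z) + \<bar>2 * \<theta> * corrector\<bar>)"
proof (induction n arbitrary: z)
  case 0
  show ?case using corrector_centred_nonneg[of "2 * \<theta>" z] by simp
next
  case (Suc n)
  define \<delta> where "\<delta> = (a - b) / (a + b)"
  have \<theta>: "0 < \<theta>" using assms ab_pos by (simp add: \<theta>_def)
  have drift: "(2 * \<theta>)\<^sup>2 / (8 * (a + b)\<^sup>2) = \<theta> * \<delta>"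
  proof -
    have "\<theta> = 2 * \<delta> * (a + b)\<^sup>2" by (simp add: \<theta>_def \<delta>_def)
    then have "(2 * \<theta>)\<^sup>2 = (\<theta> * \<delta>) * (8 * (a + b)\<^sup>2)" by (simp add: power2_eq_square)
    then show ?thesis using ab_pos by simp
  qed
  have st: "step y = 2 * centred y - \<delta>" for y
    by (simp add: step_eq_centred \<delta>_def minus_divide_left)
  let ?E = "exp \<bar>2 * \<theta> * corrector\<bar>"
  have "measure_pmf.expectation (word_law (Suc n) z) (\<lambda>w. exp (\<theta> * walk_max w))
      \<le> measure_pmf.expectation (step_law z) (\<lambda>y. 1 + exp (\<theta> * step y) *
          measure_pmf.expectation (word_law n y) (\<lambda>w. exp (\<theta> * walk_max w)))"
    unfolding expectation_word_law_Suc
  proof (rule integral_mono)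
    fix y
    have "exp (\<theta> * walk_max (y # w)) \<le> 1 + exp (\<theta> * step y) * exp (\<theta> * walk_max w)" for w
      by (simp add: max_def exp_add distrib_left)
    then have "measure_pmf.expectation (word_law n y) (\<lambda>w. exp (\<theta> * walk_max (y # w)))
        \<le> measure_pmf.expectation (word_law n y) (\<lambda>w. 1 + exp (\<theta> * step y) * exp (\<theta> * walk_max w))"
      by (intro integral_mono) auto
    also have "\<dots> = 1 + exp (\<theta> * step y) * measure_pmf.expectation (word_law n y) (\<lambda>w. exp (\<theta> * walk_max w))"
      by (subst Bochner_Integration.integral_add) auto
    finally show "measure_pmf.expectation (word_law n y) (\<lambda>w. exp (\<theta> * walk_max (y # w))) \<le> \<dots>" .
  qed auto
  also have "\<dots> \<le> measure_pmf.expectation (step_law z) (\<lambda>y. 1 + exp (\<theta> * step y) *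
        (Suc n * exp (2 * \<theta> * (corrector * centred y) + \<bar>2 * \<theta> * corrector\<bar>)))"
    by (intro integral_mono add_left_mono mult_left_mono Suc) auto
  also have "\<dots> = measure_pmf.expectation (step_law z) (\<lambda>y. 1 + (Suc n * exp (- \<theta> * \<delta>) * ?E) *
        exp (2 * \<theta> * ((1 + corrector) * centred y)))"
    by (intro Bochner_Integration.integral_cong refl) (simp add: st exp_add[symmetric] algebra_simps)
  also have "\<dots> = 1 + (Suc n * exp (- \<theta> * \<delta>) * ?E) *
        measure_pmf.expectation (step_law z) (\<lambda>y. exp (2 * \<theta> * ((1 + corrector) * centred y)))"
    by (subst Bochner_Integration.integral_add) auto
  also have "\<dots> \<le> 1 + (Suc n * exp (- \<theta> * \<delta>) * ?E) *
        exp (2 * \<theta> * (corrector * centred z) + (2 * \<theta>)\<^sup>2 / (8 * (a + b)\<^sup>2))"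
    by (intro add_left_mono mult_left_mono exp_step) auto
  also have "\<dots> = 1 + Suc n * exp (2 * \<theta> * (corrector * centred z) + \<bar>2 * \<theta> * corrector\<bar>)"
    unfolding drift by (simp add: exp_add[symmetric] mult.assoc)
  also have "\<dots> \<le> Suc (Suc n) * exp (2 * \<theta> * (corrector * centred z) + \<bar>2 * \<theta> * corrector\<bar>)"
  proof -
    have "1 \<le> exp (2 * \<theta> * (corrector * centred z) + \<bar>2 * \<theta> * corrector\<bar>)"
      using corrector_centred_nonneg[of "2 * \<theta>" z] by simp
    then show ?thesis by (simp add: algebra_simps)
  qed
  finally show ?case .
qed

text \<open>If \<open>Alpha1\<close> is the more frequent letter, the walk drifts up, and \<open>walk_max w - walk_end w\<close> is the
  maximum of the walk read backwards, which drifts down. Prepending a letter to \<open>w\<close> adds a single new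
  candidate to this maximum, minus the end point of the longer walk.\<close>

lemma exp_walk_back_bound:
  assumes "a < b"
  defines "\<theta> \<equiv> 2 * ((b - a) / (a + b)) * (a + b)\<^sup>2"
  shows "measure_pmf.expectation (word_law n z) (\<lambda>w. exp (\<theta> * (walk_max w - walk_end w)))
    \<le> Suc n * exp (2 * \<bar>2 * \<theta> * corrector\<bar>)"
proof (induction n arbitrary: z)
  case (Suc n)
  define \<delta> where "\<delta> = (b - a) / (a + b)"
  have \<theta>: "0 < \<theta>" using assms ab_pos by (simp add: \<theta>_def)
  have drift: "(- (2 * \<theta>))\<^sup>2 / (8 * (a + b)\<^sup>2) = \<theta> * \<delta>"
  proof -
    have "\<theta> = 2 * \<delta> * (a + b)\<^sup>2" by (simp add: \<theta>_def \<delta>_def)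
    then have "(- (2 * \<theta>))\<^sup>2 = (\<theta> * \<delta>) * (8 * (a + b)\<^sup>2)" by (simp add: power2_eq_square)
    then show ?thesis using ab_pos by simp
  qed
  let ?C = "exp (2 * \<bar>2 * \<theta> * corrector\<bar>)"
  have len: "AE w in measure_pmf (word_law (Suc n) z). length w = Suc n"
    using set_word_law[of "Suc n" z] by (auto intro!: AE_pmfI simp del: word_law.simps)
  have "measure_pmf.expectation (word_law (Suc n) z) (\<lambda>w. exp (- \<theta> * walk_end w))
      = measure_pmf.expectation (word_law (Suc n) z) (\<lambda>w. exp (- (\<theta> * \<delta> * Suc n)) * exp (- (2 * \<theta>) * centred_sum w))"
    using len by (intro integral_cong_AE)
      (auto elim!: AE_mp simp: walk_end_eq_centred_sum \<delta>_def[symmetric] algebra_simps exp_add[symmetric] simp del: word_law.simps of_nat_Suc)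
  also have "\<dots> = exp (- (\<theta> * \<delta> * Suc n)) * measure_pmf.expectation (word_law (Suc n) z) (\<lambda>w. exp (- (2 * \<theta>) * centred_sum w))"
    by (rule integral_mult_right_zero)
  also have "\<dots> \<le> exp (- (\<theta> * \<delta> * Suc n)) * exp (2 * \<bar>- (2 * \<theta>) * corrector\<bar> + Suc n * (\<theta> * \<delta>))"
    using exp_centred_sum_bound[of "Suc n" z "- (2 * \<theta>)"] unfolding drift by (intro mult_left_mono) auto
  also have "\<dots> = ?C"
    by (simp add: exp_add[symmetric] abs_mult del: of_nat_Suc)
  finally have fresh: "measure_pmf.expectation (word_law (Suc n) z) (\<lambda>w. exp (- \<theta> * walk_end w)) \<le> ?C" .
  have "measure_pmf.expectation (word_law (Suc n) z) (\<lambda>w. exp (\<theta> * (walk_max w - walk_end w)))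
      = measure_pmf.expectation (step_law z) (\<lambda>y. measure_pmf.expectation (word_law n y)
          (\<lambda>w. exp (\<theta> * (walk_max (y # w) - walk_end (y # w)))))"
    by (rule expectation_word_law_Suc)
  also have "\<dots> \<le> measure_pmf.expectation (step_law z) (\<lambda>y. measure_pmf.expectation (word_law n y)
          (\<lambda>w. exp (- \<theta> * walk_end (y # w)) + exp (\<theta> * (walk_max w - walk_end w))))"
  proof (intro integral_mono integrable_step_law integrable_word_law)
    fix y w
    have exp_max: "exp (\<theta> * max p q) \<le> exp (\<theta> * p) + exp (\<theta> * q)" for p q
      by (simp add: max_def)
    have "walk_max (y # w) - walk_end (y # w) = max (- walk_end (y # w)) (walk_max w - walk_end w)"
      by simp
    moreover have "- \<theta> * walk_end (y # w) = \<theta> * (- walk_end (y # w))"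
      by (simp only: mult_minus_left mult_minus_right)
    ultimately show "exp (\<theta> * (walk_max (y # w) - walk_end (y # w)))
        \<le> exp (- \<theta> * walk_end (y # w)) + exp (\<theta> * (walk_max w - walk_end w))"
      using exp_max[of "- walk_end (y # w)" "walk_max w - walk_end w"] by (simp only:)
  qed
  also have "\<dots> = measure_pmf.expectation (step_law z) (\<lambda>y. measure_pmf.expectation (word_law n y)
          (\<lambda>w. exp (- \<theta> * walk_end (y # w)))) + measure_pmf.expectation (step_law z)
          (\<lambda>y. measure_pmf.expectation (word_law n y) (\<lambda>w. exp (\<theta> * (walk_max w - walk_end w))))"
    by (simp only: Bochner_Integration.integral_add integrable_word_law integrable_step_law)
  also have "\<dots> \<le> ?C + measure_pmf.expectation (step_law z) (\<lambda>y. Suc n * ?C)"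
    using fresh unfolding expectation_word_law_Suc
    by (intro add_mono integral_mono Suc) auto
  also have "\<dots> = Suc (Suc n) * ?C" by (simp add: algebra_simps)
  finally show ?case .
qed simp

lemma char_centred_sum_sqrt:
  "(\<lambda>n. measure_pmf.expectation (word_law n z) (\<lambda>w. iexp (u * (centred_sum w / sqrt n))))
    \<longlonglongrightarrow> char (normal_law 0 asym_var) u"
proof -
  have "(\<lambda>n. measure_pmf.expectation (word_law n z) (\<lambda>w. iexp (u / sqrt n * centred_sum w)))
      \<longlonglongrightarrow> of_real (exp (- (asym_var * u\<^sup>2 / 2)))"
  proof (rule char_centred_sum_tendsto)
    show "(\<lambda>n. u / sqrt (real n)) \<longlonglongrightarrow> 0" by real_asymp
    have "eventually (\<lambda>n. real n * (u / sqrt n)\<^sup>2 = u\<^sup>2) sequentially"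
      using eventually_gt_at_top[of 0] by eventually_elim (simp add: power_divide)
    then show "(\<lambda>n. real n * (u / sqrt n)\<^sup>2) \<longlonglongrightarrow> u\<^sup>2" by (rule tendsto_eventually)
  qed
  then show ?thesis by (simp add: char_normal_law asym_var_nonneg)
qed

lemma char_limit_negligible:
  fixes f g :: "letter list \<Rightarrow> real" and C :: real
  assumes lim: "\<And>u. (\<lambda>n. measure_pmf.expectation (word_law n z) (\<lambda>w. iexp (u * (f w / sqrt n)))) \<longlonglongrightarrow> L u"
    and nonneg: "\<And>w. 0 \<le> g w" and \<theta>: "0 < \<theta>"
    and exp: "\<And>n. measure_pmf.expectation (word_law n z) (\<lambda>w. exp (\<theta> * g w)) \<le> Suc n * C"
  shows "(\<lambda>n. measure_pmf.expectation (word_law n z) (\<lambda>w. iexp (u * ((f w + g w) / sqrt n)))) \<longlonglongrightarrow> L u"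
proof -
  let ?E = "\<lambda>n h. measure_pmf.expectation (word_law n z) h"
  have bound: "norm (?E n (\<lambda>w. iexp (u * ((f w + g w) / sqrt n))) - ?E n (\<lambda>w. iexp (u * (f w / sqrt n))))
      \<le> \<bar>u\<bar> / sqrt n * ((ln (Suc n) + C) / \<theta>)" for n
  proof -
    have "norm (?E n (\<lambda>w. iexp (u * ((f w + g w) / sqrt n))) - ?E n (\<lambda>w. iexp (u * (f w / sqrt n))))
      = norm (?E n (\<lambda>w. iexp (u * ((f w + g w) / sqrt n)) - iexp (u * (f w / sqrt n))))"
      by (subst Bochner_Integration.integral_diff) auto
    also have "\<dots> \<le> ?E n (\<lambda>w. norm (iexp (u * ((f w + g w) / sqrt n)) - iexp (u * (f w / sqrt n))))"
      by (rule integral_norm_bound)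
    also have "\<dots> \<le> ?E n (\<lambda>w. \<bar>u\<bar> / sqrt n * g w)"
    proof (intro integral_mono integrable_word_law)
      fix w
      have "u * ((f w + g w) / sqrt n) - u * (f w / sqrt n) = u / sqrt n * g w"
        by (simp add: add_divide_distrib algebra_simps)
      then have "\<bar>u * ((f w + g w) / sqrt n) - u * (f w / sqrt n)\<bar> = \<bar>u\<bar> / sqrt n * g w"
        using nonneg[of w] by (simp add: abs_mult)
      with norm_iexp_diff_le[of "u * ((f w + g w) / sqrt n)" "u * (f w / sqrt n)"]
      show "norm (iexp (u * ((f w + g w) / sqrt n)) - iexp (u * (f w / sqrt n))) \<le> \<bar>u\<bar> / sqrt n * g w"
        by simp
    qed
    also have "\<dots> = \<bar>u\<bar> / sqrt n * ?E n g" by (rule integral_mult_right_zero)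
    also have "\<dots> \<le> \<bar>u\<bar> / sqrt n * ((ln (Suc n) + C) / \<theta>)"
      by (intro mult_left_mono expectation_from_exp_moment[OF \<theta> exp]) simp
    finally show ?thesis .
  qed
  have vanish: "(\<lambda>n. \<bar>u\<bar> / sqrt n * ((ln (Suc n) + C) / \<theta>)) \<longlonglongrightarrow> 0"
  proof -
    have "(\<lambda>n. (ln (real (Suc n)) + C) / sqrt (real n)) \<longlonglongrightarrow> 0" by real_asymp
    from tendsto_mult_left[OF this, of "\<bar>u\<bar> / \<theta>"] show ?thesis by (simp add: mult_ac)
  qed
  have "(\<lambda>n. ?E n (\<lambda>w. iexp (u * ((f w + g w) / sqrt n))) - ?E n (\<lambda>w. iexp (u * (f w / sqrt n)))) \<longlonglongrightarrow> 0"
    by (rule Lim_null_comparison[OF always_eventually[OF allI[OF bound]] vanish])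
  from tendsto_add[OF this lim[of u]] show ?thesis by simp
qed

text \<open>The top row is the number of occurrences of the more frequent letter plus a negligible maximum;
  only the former fluctuates on the scale \<open>sqrt n\<close>. The sign of the fluctuation differs between the two
  cases, and the normal law is symmetric.\<close>

lemma char_top_row_biased:
  assumes "a \<noteq> b"
  shows "(\<lambda>n. measure_pmf.expectation (word_law n z)
      (\<lambda>w. iexp (u * ((top_row w - n * (max a b / (a + b))) / sqrt n)))) \<longlonglongrightarrow> char (normal_law 0 asym_var) u"
proof -
  define \<delta> where "\<delta> = (b - a) / (a + b)"
  have hi: "b / (a + b) = (1 + \<delta>) / 2" and lo: "a / (a + b) = (1 - \<delta>) / 2"
    using ab_pos by (simp_all add: \<delta>_def field_simps)
  have eq: "measure_pmf.expectation (word_law n z)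
      (\<lambda>w. iexp (u * ((top_row w - n * (max a b / (a + b))) / sqrt n)))
    = measure_pmf.expectation (word_law n z) (\<lambda>w. iexp (u * ((f w + g w) / sqrt n)))"
    if "\<And>w. top_row w - length w * (max a b / (a + b)) = f w + g w" for n f g
  proof (rule integral_cong_AE)
    show "AE w in measure_pmf (word_law n z). iexp (u * ((top_row w - n * (max a b / (a + b))) / sqrt n))
      = iexp (u * ((f w + g w) / sqrt n))"
    proof (rule AE_pmfI)
      fix w assume "w \<in> set_pmf (word_law n z)"
      then have "length w = n" using set_word_law by auto
      with that[of w] show "iexp (u * ((top_row w - n * (max a b / (a + b))) / sqrt n))
        = iexp (u * ((f w + g w) / sqrt n))" by simp
    qed
  qed simp_all
  show ?thesis
  proof (cases "a < b")
    case True
    have dec: "top_row w - length w * (max a b / (a + b)) = centred_sum w + (walk_max w - walk_end w)" for w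
    proof -
      have m: "max a b / (a + b) = (1 + \<delta>) / 2" using True hi by simp
      show ?thesis unfolding top_row_def walk_end_eq_centred_sum \<delta>_def[symmetric] m
        by (simp add: field_simps)
    qed
    show ?thesis unfolding eq[OF dec]
      using True ab_pos walk_end_le_max
      by (intro char_limit_negligible[OF char_centred_sum_sqrt _ _ exp_walk_back_bound]) auto
  next
    case False
    then have ba: "b < a" using assms by simp
    have dec: "top_row w - length w * (max a b / (a + b)) = - centred_sum w + walk_max w" for w
    proof -
      have m: "max a b / (a + b) = (1 - \<delta>) / 2" using ba lo by simp
      show ?thesis unfolding top_row_def walk_end_eq_centred_sum \<delta>_def[symmetric] m
        by (simp add: field_simps)
    qed
    have "(\<lambda>n. measure_pmf.expectation (word_law n z) (\<lambda>w. iexp (u * (- centred_sum w / sqrt n))))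
      \<longlonglongrightarrow> char (normal_law 0 asym_var) u" for u
      using char_centred_sum_sqrt[of z "- u"] by (simp add: char_normal_law asym_var_nonneg)
    then show ?thesis unfolding eq[OF dec]
      using ba ab_pos by (intro char_limit_negligible[OF _ _ _ exp_walk_max_bound]) auto
  qed
qed

end

section \<open>Gaussian walks on a grid and Brownian motion\<close>

text \<open>The arguments are the position of a walk and its running maximum. With the maximum norm on pairs,
  the update \<open>(s, g) \<mapsto> (s + x, max g (s + x))\<close> does not expand distances, so the constant \<open>L\<close> survives
  any number of steps.\<close>

definition bdd_lip :: "real \<Rightarrow> real \<Rightarrow> (real \<Rightarrow> real \<Rightarrow> real) \<Rightarrow> bool" where
  "bdd_lip C L \<psi> \<longleftrightarrow> 0 \<le> L \<and> (\<forall>s g. \<bar>\<psi> s g\<bar> \<le> C) \<and>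
     (\<forall>s g s' g'. \<bar>\<psi> s g - \<psi> s' g'\<bar> \<le> L * max \<bar>s - s'\<bar> \<bar>g - g'\<bar>)"

text \<open>The transition operator of a Gaussian walk together with its running maximum.\<close>

definition gauss_step :: "real \<Rightarrow> (real \<Rightarrow> real \<Rightarrow> real) \<Rightarrow> real \<Rightarrow> real \<Rightarrow> real" where
  "gauss_step v \<psi> s g = (\<integral>x. \<psi> (s + x) (max g (s + x)) \<partial>normal_law 0 v)"

lemma bdd_lip_continuous:
  assumes "bdd_lip C L \<psi>"
  shows "continuous_on UNIV (\<lambda>p. \<psi> (fst p) (snd p))"
proof (rule lipschitz_on_continuous_on[where L = L], rule lipschitz_onI)
  fix p q :: "real \<times> real"
  have "dist (fst p) (fst q) \<le> dist p q" "dist (snd p) (snd q) \<le> dist p q"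
    by (rule dist_fst_le dist_snd_le)+
  then have "max \<bar>fst p - fst q\<bar> \<bar>snd p - snd q\<bar> \<le> dist p q"
    by (simp add: dist_real_def)
  moreover have "\<bar>\<psi> (fst p) (snd p) - \<psi> (fst q) (snd q)\<bar> \<le> L * max \<bar>fst p - fst q\<bar> \<bar>snd p - snd q\<bar>"
    "0 \<le> L" using assms by (simp_all add: bdd_lip_def)
  ultimately show "dist (\<psi> (fst p) (snd p)) (\<psi> (fst q) (snd q)) \<le> L * dist p q"
    unfolding dist_real_def using mult_left_mono[of "max \<bar>fst p - fst q\<bar> \<bar>snd p - snd q\<bar>" "dist p q" L] by linarith
qed (use assms in \<open>simp add: bdd_lip_def\<close>)

lemma bdd_lip_measurable:
  assumes "bdd_lip C L \<psi>" and [measurable]: "f \<in> borel_measurable M" "g \<in> borel_measurable M"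
  shows "(\<lambda>x. \<psi> (f x) (g x)) \<in> borel_measurable M"
  by (rule borel_measurable_continuous_Pair[OF assms(2,3) bdd_lip_continuous[OF assms(1)]])

lemma bdd_lip_shift:
  assumes "bdd_lip C L \<psi>"
  shows "\<bar>\<psi> (s + x) (max g (s + x)) - \<psi> (s' + x') (max g' (s' + x'))\<bar>
    \<le> L * (max \<bar>s - s'\<bar> \<bar>g - g'\<bar> + \<bar>x - x'\<bar>)"
proof -
  have "max \<bar>(s + x) - (s' + x')\<bar> \<bar>max g (s + x) - max g' (s' + x')\<bar>
      \<le> max \<bar>s - s'\<bar> \<bar>g - g'\<bar> + \<bar>x - x'\<bar>"
    by (auto simp: max_def abs_if)
  moreover have "\<bar>\<psi> (s + x) (max g (s + x)) - \<psi> (s' + x') (max g' (s' + x'))\<bar>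
      \<le> L * max \<bar>(s + x) - (s' + x')\<bar> \<bar>max g (s + x) - max g' (s' + x')\<bar>" "0 \<le> L"
    using assms unfolding bdd_lip_def by blast+
  ultimately show ?thesis using mult_left_mono order_trans by blast
qed

lemma bdd_lip_gauss_step:
  assumes v: "0 \<le> v" and \<psi>: "bdd_lip C L \<psi>"
  shows "bdd_lip C L (gauss_step v \<psi>)"
proof -
  interpret V: real_distribution "normal_law 0 v" using v by simp
  have int: "integrable (normal_law 0 v) (\<lambda>x. \<psi> (s + x) (max g (s + x)))" for s g
    using \<psi> by (intro V.integrable_const_bound[where B = C] bdd_lip_measurable[OF \<psi>])
      (auto simp: bdd_lip_def)
  have L: "0 \<le> L" using \<psi> by (simp add: bdd_lip_def)
  have avg: "\<bar>\<integral>x. f x \<partial>normal_law 0 v\<bar> \<le> B" if "\<And>x. \<bar>f x\<bar> \<le> B" "integrable (normal_law 0 v) f" for f :: "real \<Rightarrow> real" and B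
  proof -
    have "\<bar>\<integral>x. f x \<partial>normal_law 0 v\<bar> \<le> (\<integral>x. \<bar>f x\<bar> \<partial>normal_law 0 v)"
      using integral_norm_bound[of "normal_law 0 v" f] by simp
    also have "\<dots> \<le> (\<integral>x. B \<partial>normal_law 0 v)" using that by (intro integral_mono) auto
    finally show ?thesis using V.prob_space by simp
  qed
  show ?thesis unfolding bdd_lip_def
  proof (intro conjI allI L)
    show "\<bar>gauss_step v \<psi> s g\<bar> \<le> C" for s g
      unfolding gauss_step_def using \<psi> by (intro avg int) (auto simp: bdd_lip_def)
    fix s g s' g'
    have "gauss_step v \<psi> s g - gauss_step v \<psi> s' g' =
      (\<integral>x. \<psi> (s + x) (max g (s + x)) - \<psi> (s' + x) (max g' (s' + x)) \<partial>normal_law 0 v)"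
      unfolding gauss_step_def by (simp add: int)
    also have "\<bar>\<dots>\<bar> \<le> L * max \<bar>s - s'\<bar> \<bar>g - g'\<bar>"
    proof (rule avg)
      show "\<bar>\<psi> (s + x) (max g (s + x)) - \<psi> (s' + x) (max g' (s' + x))\<bar> \<le> L * max \<bar>s - s'\<bar> \<bar>g - g'\<bar>" for x
        using bdd_lip_shift[OF \<psi>, of s x g s' x g'] by simp
    qed (use int in simp)
    finally show "\<bar>gauss_step v \<psi> s g - gauss_step v \<psi> s' g'\<bar> \<le> L * max \<bar>s - s'\<bar> \<bar>g - g'\<bar>" .
  qed
qed

text \<open>Weak convergence is uniform over bounded Lipschitz functions: on a probability space where the
  variables converge almost surely, one dominating sequence serves all these functions at once.\<close>

lemma weak_conv_uniform_bdd_lip: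
  assumes \<mu>: "\<And>n. real_distribution (\<mu> n)" and \<nu>: "real_distribution \<nu>" and wc: "weak_conv_m \<mu> \<nu>"
    and \<epsilon>: "0 < \<epsilon>"
  shows "eventually (\<lambda>n. \<forall>h :: real \<Rightarrow> real. (\<forall>x. \<bar>h x\<bar> \<le> C) \<longrightarrow> (\<forall>x y. \<bar>h x - h y\<bar> \<le> L * \<bar>x - y\<bar>) \<longrightarrow>
    h \<in> borel_measurable borel \<longrightarrow> \<bar>integral\<^sup>L (\<mu> n) h - integral\<^sup>L \<nu> h\<bar> < \<epsilon>) sequentially"
proof -
  obtain \<Omega> :: "real measure" and Y_seq Y where ps: "prob_space \<Omega>"
    and [measurable]: "\<And>n. Y_seq n \<in> measurable \<Omega> borel" "Y \<in> borel_measurable \<Omega>"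
    and d: "\<And>n. distr \<Omega> borel (Y_seq n) = \<mu> n" "distr \<Omega> borel Y = \<nu>"
    and lim: "\<And>x. x \<in> space \<Omega> \<Longrightarrow> (\<lambda>n. Y_seq n x) \<longlonglongrightarrow> Y x"
    using Skorohod[OF \<mu> \<nu> wc] by force
  interpret prob_space \<Omega> by fact
  define b where "b n x = min (2 * \<bar>C\<bar>) (\<bar>L\<bar> * \<bar>Y_seq n x - Y x\<bar>)" for n x
  have [measurable]: "b n \<in> borel_measurable \<Omega>" for n unfolding b_def by measurable
  have b0: "0 \<le> b n x" "b n x \<le> 2 * \<bar>C\<bar>" for n x by (simp_all add: b_def)
  have "(\<lambda>n. integral\<^sup>L \<Omega> (b n)) \<longlonglongrightarrow> integral\<^sup>L \<Omega> (\<lambda>x. 0)"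
  proof (rule integral_dominated_convergence[where w = "\<lambda>_. 2 * \<bar>C\<bar>"])
    show "AE x in \<Omega>. (\<lambda>n. b n x) \<longlonglongrightarrow> 0"
    proof (rule AE_I2)
      fix x assume "x \<in> space \<Omega>"
      then have "(\<lambda>n. min (2 * \<bar>C\<bar>) (\<bar>L\<bar> * \<bar>Y_seq n x - Y x\<bar>)) \<longlonglongrightarrow> min (2 * \<bar>C\<bar>) (\<bar>L\<bar> * \<bar>Y x - Y x\<bar>)"
        by (intro tendsto_intros lim)
      then show "(\<lambda>n. b n x) \<longlonglongrightarrow> 0" by (simp add: b_def)
    qed
  qed (use b0 in auto)
  then have "eventually (\<lambda>n. integral\<^sup>L \<Omega> (b n) < \<epsilon>) sequentially"
    using order_tendstoD(2) \<epsilon> by fastforce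
  then show ?thesis
  proof (rule eventually_mono, intro allI impI)
    fix n and h :: "real \<Rightarrow> real"
    assume lt: "integral\<^sup>L \<Omega> (b n) < \<epsilon>" and C: "\<forall>x. \<bar>h x\<bar> \<le> C" and L: "\<forall>x y. \<bar>h x - h y\<bar> \<le> L * \<bar>x - y\<bar>"
      and [measurable]: "h \<in> borel_measurable borel"
    have int: "integrable \<Omega> (\<lambda>x. h (Y_seq n x))" "integrable \<Omega> (\<lambda>x. h (Y x))"
      using C by (auto intro!: integrable_const_bound[where B = C])
    have intb: "integrable \<Omega> (b n)"
      using b0 by (auto intro!: integrable_const_bound[where B = "2 * \<bar>C\<bar>"])
    have "\<bar>integral\<^sup>L (\<mu> n) h - integral\<^sup>L \<nu> h\<bar> = \<bar>\<integral>x. h (Y_seq n x) - h (Y x) \<partial>\<Omega>\<bar>"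
      using int unfolding d(1)[symmetric, of n] d(2)[symmetric] by (simp add: integral_distr)
    also have "\<dots> \<le> (\<integral>x. \<bar>h (Y_seq n x) - h (Y x)\<bar> \<partial>\<Omega>)"
      using integral_norm_bound[of \<Omega> "\<lambda>x. h (Y_seq n x) - h (Y x)"] by simp
    also have "\<dots> \<le> integral\<^sup>L \<Omega> (b n)"
    proof (rule integral_mono)
      fix x
      have "\<bar>h (Y_seq n x) - h (Y x)\<bar> \<le> L * \<bar>Y_seq n x - Y x\<bar>" using L by blast
      also have "\<dots> \<le> \<bar>L\<bar> * \<bar>Y_seq n x - Y x\<bar>" by (intro mult_right_mono) auto
      finally have 1: "\<bar>h (Y_seq n x) - h (Y x)\<bar> \<le> \<bar>L\<bar> * \<bar>Y_seq n x - Y x\<bar>" .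
      have "\<bar>h (Y_seq n x)\<bar> \<le> C" "\<bar>h (Y x)\<bar> \<le> C" using C by auto
      with 1 show "\<bar>h (Y_seq n x) - h (Y x)\<bar> \<le> b n x" by (simp add: b_def)
    qed (use int intb in auto)
    finally show "\<bar>integral\<^sup>L (\<mu> n) h - integral\<^sup>L \<nu> h\<bar> < \<epsilon>" using lt by simp
  qed
qed

primrec running_max :: "(nat \<Rightarrow> real) \<Rightarrow> nat \<Rightarrow> real" where
  "running_max x 0 = 0"
| "running_max x (Suc j) = max (running_max x j) (\<Sum>i<Suc j. x i)"

lemma measurable_partial_sums:
  fixes j k :: nat
  assumes "j \<le> k"
  shows "(\<lambda>x. \<Sum>i<j. x i) \<in> borel_measurable (PiM {..<k} (\<lambda>_. borel :: real measure))"
  using assms by (intro borel_measurable_sum measurable_component_singleton) simp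

lemma measurable_running_max:
  assumes "j \<le> k"
  shows "(\<lambda>x. running_max x j) \<in> borel_measurable (PiM {..<k} (\<lambda>_. borel :: real measure))"
  using assms
proof (induction j)
  case (Suc j)
  have "(\<lambda>x. running_max x (Suc j)) = (\<lambda>x. max (running_max x j) (\<Sum>i<Suc j. x i))" by simp
  then show ?case using Suc
    by (simp only:) (intro borel_measurable_max measurable_partial_sums, auto)
qed simp

lemma running_max_cong: "(\<And>i. i < j \<Longrightarrow> x i = y i) \<Longrightarrow> running_max x j = running_max y j"
  by (induction j) (auto intro!: arg_cong2[of _ _ _ _ max] sum.cong)

text \<open>The last increment is independent of the position and maximum reached before, and integrating it
  out is one application of \<open>gauss_step\<close>.\<close>

lemma (in prob_space) gauss_step_iterates:
  assumes v: "0 \<le> v" and indep: "indep_vars (\<lambda>_. borel) X {..<m}"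
    and law: "\<And>i. i < m \<Longrightarrow> distr M borel (X i) = normal_law 0 v"
    and "j \<le> m" and "bdd_lip C L \<psi>"
  shows "(\<integral>\<omega>. \<psi> (\<Sum>i<j. X i \<omega>) (running_max (\<lambda>i. X i \<omega>) j) \<partial>M) = (gauss_step v ^^ j) \<psi> 0 0"
  using assms(4,5)
proof (induction j arbitrary: \<psi>)
  case 0
  then show ?case by (simp add: prob_space)
next
  case (Suc j)
  interpret V: real_distribution "normal_law 0 v" using v by simp
  let ?P = "PiM {..<j} (\<lambda>_. borel :: real measure)" and ?Q = "PiM {j} (\<lambda>_. borel :: real measure)"
  define F where "F x = (\<Sum>i<j. x i :: real, running_max x j)" for x
  have F: "F \<in> measurable ?P (borel \<Otimes>\<^sub>M borel)"
    unfolding F_def by (intro measurable_Pair measurable_partial_sums measurable_running_max) auto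
  have ind: "indep_var (borel \<Otimes>\<^sub>M borel) (F \<circ> (\<lambda>\<omega>. restrict (\<lambda>i. X i \<omega>) {..<j}))
      (borel \<Otimes>\<^sub>M borel) ((\<lambda>x. (x j, 0)) \<circ> (\<lambda>\<omega>. restrict (\<lambda>i. X i \<omega>) {j}))"
    by (rule indep_var_compose[OF indep_var_restrict[OF indep] F])
       (use Suc.prems in \<open>auto intro!: measurable_component_singleton measurable_Pair\<close>)
  \<comment> \<open>\<open>indep_var\<close> relates variables of one value type, so the increment is padded to a pair.\<close>
  define W where "W \<omega> = (X j \<omega>, 0 :: real)" for \<omega>
  define Z where "Z \<omega> = (\<Sum>i<j. X i \<omega>, running_max (\<lambda>i. X i \<omega>) j)" for \<omega>
  have FZ: "F \<circ> (\<lambda>\<omega>. restrict (\<lambda>i. X i \<omega>) {..<j}) = Z"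
    by (auto simp: fun_eq_iff F_def Z_def intro!: sum.cong running_max_cong)
  have XW: "(\<lambda>x. (x j, 0)) \<circ> (\<lambda>\<omega>. restrict (\<lambda>i. X i \<omega>) {j}) = W" by (auto simp: fun_eq_iff W_def)
  note ind = ind[unfolded FZ XW]
  from indep_var_rv1[OF ind] indep_var_rv2[OF ind]
  have [measurable]: "Z \<in> measurable M (borel \<Otimes>\<^sub>M borel)" "W \<in> measurable M (borel \<Otimes>\<^sub>M borel)" by auto
  have [measurable]: "X j \<in> borel_measurable M"
    using indep Suc.prems by (auto simp: indep_vars_def)
  define H where "H p r = \<psi> (fst p + fst r) (max (snd p) (fst p + fst r))" for p r :: "real \<times> real"
  have H [measurable]: "(\<lambda>q. H (fst q) (snd q)) \<in> borel_measurable ((borel \<Otimes>\<^sub>M borel) \<Otimes>\<^sub>M (borel \<Otimes>\<^sub>M borel))"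
    unfolding H_def by (intro bdd_lip_measurable[OF Suc.prems(2)]) measurable
  let ?DZ = "distr M (borel \<Otimes>\<^sub>M borel) Z" and ?DW = "distr M (borel \<Otimes>\<^sub>M borel) W"
  interpret DZ: prob_space ?DZ by (rule prob_space_distr) simp
  interpret DW: prob_space ?DW by (rule prob_space_distr) simp
  interpret DV: pair_prob_space ?DZ ?DW ..
  have inner: "(\<integral>r. H p r \<partial>?DW) = gauss_step v \<psi> (fst p) (snd p)" for p
  proof -
    have m: "(\<lambda>x. \<psi> (fst p + x) (max (snd p) (fst p + x))) \<in> borel_measurable borel"
      by (intro bdd_lip_measurable[OF Suc.prems(2)]) measurable
    have "(\<integral>r. H p r \<partial>?DW) = (\<integral>\<omega>. \<psi> (fst p + X j \<omega>) (max (snd p) (fst p + X j \<omega>)) \<partial>M)"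
      unfolding H_def
      by (subst integral_distr) (auto simp: W_def intro!: bdd_lip_measurable[OF Suc.prems(2)])
    also have "\<dots> = (\<integral>x. \<psi> (fst p + x) (max (snd p) (fst p + x)) \<partial>distr M borel (X j))"
      using m by (subst integral_distr) auto
    finally show ?thesis using law[of j] Suc.prems by (simp add: gauss_step_def)
  qed
  have "(\<integral>\<omega>. \<psi> (\<Sum>i<Suc j. X i \<omega>) (running_max (\<lambda>i. X i \<omega>) (Suc j)) \<partial>M)
      = (\<integral>\<omega>. H (Z \<omega>) (W \<omega>) \<partial>M)"
    by (simp add: H_def Z_def W_def)
  also have "\<dots> = (\<integral>q. H (fst q) (snd q) \<partial>distr M ((borel \<Otimes>\<^sub>M borel) \<Otimes>\<^sub>M (borel \<Otimes>\<^sub>M borel)) (\<lambda>\<omega>. (Z \<omega>, W \<omega>)))"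
    by (subst integral_distr) auto
  also have "distr M ((borel \<Otimes>\<^sub>M borel) \<Otimes>\<^sub>M (borel \<Otimes>\<^sub>M borel)) (\<lambda>\<omega>. (Z \<omega>, W \<omega>)) = ?DZ \<Otimes>\<^sub>M ?DW"
    using indep_var_distribution_eq[THEN iffD1, OF ind] by simp
  also have "(\<integral>q. H (fst q) (snd q) \<partial>(?DZ \<Otimes>\<^sub>M ?DW)) = (\<integral>p. (\<integral>r. H p r \<partial>?DW) \<partial>?DZ)"
  proof (subst DV.integral_fst'[symmetric])
    have "(\<lambda>q. H (fst q) (snd q)) \<in> borel_measurable (?DZ \<Otimes>\<^sub>M ?DW)"
      by (subst measurable_cong_sets[OF _ refl, of _ "(borel \<Otimes>\<^sub>M borel) \<Otimes>\<^sub>M (borel \<Otimes>\<^sub>M borel)"])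
         (auto intro!: sets_pair_measure_cong H)
    then show "integrable (?DZ \<Otimes>\<^sub>M ?DW) (\<lambda>q. H (fst q) (snd q))"
      using Suc.prems(2)
      by (intro DV.P.integrable_const_bound[where B = C]) (auto simp: H_def bdd_lip_def)
  qed simp
  also have "\<dots> = (\<integral>p. gauss_step v \<psi> (fst p) (snd p) \<partial>?DZ)"
    unfolding inner ..
  also have "\<dots> = (\<integral>\<omega>. gauss_step v \<psi> (\<Sum>i<j. X i \<omega>) (running_max (\<lambda>i. X i \<omega>) j) \<partial>M)"
    by (subst integral_distr)
       (auto simp: Z_def intro!: bdd_lip_measurable[OF bdd_lip_gauss_step[OF v Suc.prems(2)]])
  also have "\<dots> = (gauss_step v ^^ j) (gauss_step v \<psi>) 0 0"
    using Suc.prems by (intro Suc.IH bdd_lip_gauss_step[OF v]) auto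
  finally show ?case by (simp add: funpow_swap1)
qed

lemma running_max_telescope:
  assumes "y 0 = 0" and "\<And>i. x i = y (Suc i) - y i"
  shows "(\<Sum>i<j. x i) = y j" and "running_max x j = Max (y ` {..j})"
proof -
  show sum: "(\<Sum>i<j. x i) = y j" for j
    using assms by (induction j) auto
  show "running_max x j = Max (y ` {..j})"
  proof (induction j)
    case (Suc j)
    have "{..Suc j} = insert (Suc j) {..j}" by auto
    then show ?case using Suc sum[of "Suc j"] by (simp add: max.commute del: sum.lessThan_Suc)
  qed (use assms in simp)
qed

text \<open>The supremum is attained at some \<open>t\<close>, and the grid points \<open>\<lfloor>t * m\<rfloor> / m\<close> tend to \<open>t\<close>.\<close>

lemma grid_max_tendsto_sup:
  fixes f :: "real \<Rightarrow> real"
  assumes f: "continuous_on {0..1} f"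
  shows "(\<lambda>m. Max ((\<lambda>i. f (real i / real (Suc m))) ` {..Suc m})) \<longlonglongrightarrow> (SUP t\<in>{0..1}. f t)"
proof -
  obtain t where t: "t \<in> {0..1}" and max: "\<And>s. s \<in> {0..1} \<Longrightarrow> f s \<le> f t"
    using continuous_attains_sup[OF compact_Icc _ f] by auto
  have sup: "(SUP t\<in>{0..1}. f t) = f t"
    using t max by (intro cSup_eq_maximum) auto
  define i where "i m = nat \<lfloor>t * Suc m\<rfloor>" for m
  have i: "i m \<le> Suc m" "real (i m) / Suc m \<in> {0..1}" for m
  proof -
    have "t * real (Suc m) \<le> 1 * real (Suc m)" using t by (intro mult_right_mono) auto
    then have "\<lfloor>t * real (Suc m)\<rfloor> \<le> \<lfloor>real (Suc m)\<rfloor>" by (intro floor_mono) simp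
    then have "\<lfloor>t * real (Suc m)\<rfloor> \<le> int (Suc m)" by (simp only: floor_of_nat)
    then show "i m \<le> Suc m" by (simp add: i_def)
    then show "real (i m) / Suc m \<in> {0..1}" by (simp add: divide_le_eq_1)
  qed
  have lower: "f (real (i m) / Suc m) \<le> Max ((\<lambda>i. f (real i / real (Suc m))) ` {..Suc m})" for m
    using i(1)[of m] by (intro Max_ge) auto
  have upper: "Max ((\<lambda>i. f (real i / real (Suc m))) ` {..Suc m}) \<le> f t" for m
    by (subst Max_le_iff) (auto intro!: max simp: divide_le_eq_1 simp del: of_nat_Suc)
  have near: "norm (real (i m) / Suc m - t) \<le> 1 / real (Suc m)" for m
  proof -
    have "0 \<le> t * Suc m" using t by simp
    then have "real (i m) = of_int \<lfloor>t * Suc m\<rfloor>" unfolding i_def by simp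
    then have "\<bar>real (i m) - t * Suc m\<bar> \<le> 1" by linarith
    then have "\<bar>real (i m) - t * Suc m\<bar> / Suc m \<le> 1 / Suc m" by (intro divide_right_mono) auto
    moreover have "real (i m) / Suc m - t = (real (i m) - t * Suc m) / Suc m"
      by (simp add: diff_divide_distrib del: of_nat_Suc)
    ultimately show ?thesis by (simp add: abs_divide del: of_nat_Suc)
  qed
  have "(\<lambda>m. 1 / real (Suc m)) \<longlonglongrightarrow> 0" by real_asymp
  from Lim_null_comparison[OF always_eventually[OF allI[OF near]] this]
  have "(\<lambda>m. real (i m) / Suc m) \<longlonglongrightarrow> t" by (rule LIM_zero_cancel)
  from continuous_on_tendsto_compose[OF f this t always_eventually[OF allI[OF i(2)]]]
  have "(\<lambda>m. f (real (i m) / Suc m)) \<longlonglongrightarrow> f t" .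
  then show ?thesis unfolding sup
    by (rule tendsto_sandwich[OF always_eventually[OF allI[OF lower]] always_eventually[OF allI[OF upper]] _ tendsto_const])
qed

lemma standard_brownian_motion_sup_measurable:
  assumes BM: "standard_brownian_motion N B"
  shows "(\<lambda>\<omega>. SUP t\<in>{0..1}. B t \<omega>) \<in> borel_measurable N"
proof (rule borel_measurable_LIMSEQ_real)
  fix \<omega> assume "\<omega> \<in> space N"
  then have "continuous_on {0..1} (\<lambda>t. B t \<omega>)" using BM by (simp add: standard_brownian_motion_def)
  then show "(\<lambda>m. Max ((\<lambda>i. B (real i / real (Suc m)) \<omega>) ` {..Suc m})) \<longlonglongrightarrow> (SUP t\<in>{0..1}. B t \<omega>)"
    by (rule grid_max_tendsto_sup)
next
  fix m
  have "B (real i / real (Suc m)) \<in> borel_measurable N" if "i \<le> Suc m" for i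
  proof -
    have "real i / real (Suc m) \<in> {0..1}" using that by (simp add: divide_le_eq_1 del: of_nat_Suc)
    then show ?thesis using BM by (simp only: standard_brownian_motion_def)
  qed
  then show "(\<lambda>\<omega>. Max ((\<lambda>i. B (real i / real (Suc m)) \<omega>) ` {..Suc m})) \<in> borel_measurable N"
    by (intro borel_measurable_Max) auto
qed

text \<open>Observed on a grid of mesh \<open>1 / (m + 1)\<close>, the scaled Brownian motion is exactly a Gaussian walk,
  without any limit. The index \<open>Suc m\<close> avoids the empty grid.\<close>

lemma gauss_step_brownian_grid:
  assumes BM: "standard_brownian_motion N B" and \<sigma>: "0 \<le> \<sigma>" and \<psi>: "bdd_lip C L \<psi>"
  shows "(gauss_step (\<sigma>\<^sup>2 / Suc m) ^^ Suc m) \<psi> 0 0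
    = (\<integral>\<omega>. \<psi> (\<sigma> * B 1 \<omega>) (\<sigma> * Max ((\<lambda>i. B (real i / real (Suc m)) \<omega>) ` {..Suc m})) \<partial>N)"
proof -
  let ?t = "\<lambda>i. real i / real (Suc m)"
  interpret prob_space N using BM by (simp add: standard_brownian_motion_def)
  have B0: "B 0 \<omega> = 0" if "\<omega> \<in> space N" for \<omega>
    using BM that by (simp add: standard_brownian_motion_def)
  have incr: "distr N borel (\<lambda>\<omega>. B t \<omega> - B s \<omega>) = normal_law 0 (t - s)" if "0 \<le> s" "s < t" "t \<le> 1" for s t
    using BM that by (simp add: standard_brownian_motion_def)
  have ind: "indep_vars (\<lambda>_. borel) (\<lambda>i \<omega>. B (?t (Suc i)) \<omega> - B (?t i) \<omega>) {..<Suc m}"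
  proof -
    have "\<forall>k t. 0 \<le> t 0 \<and> (\<forall>i<k. t i < t (Suc i)) \<and> t k \<le> 1 \<longrightarrow>
        indep_vars (\<lambda>_. borel) (\<lambda>i \<omega>. B (t (Suc i)) \<omega> - B (t i) \<omega>) {..<k}"
      using BM unfolding standard_brownian_motion_def by blast
    from this[rule_format, of ?t "Suc m"] show ?thesis
      by (simp add: divide_strict_right_mono del: of_nat_Suc)
  qed
  define X where "X i \<omega> = \<sigma> * (B (?t (Suc i)) \<omega> - B (?t i) \<omega>)" for i \<omega>
  have indX: "indep_vars (\<lambda>_. borel) X {..<Suc m}"
    unfolding X_def by (rule indep_vars_compose2[OF ind]) simp
  have lawX: "distr N borel (X i) = normal_law 0 (\<sigma>\<^sup>2 / Suc m)" if "i < Suc m" for i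
  proof -
    have rv: "(\<lambda>\<omega>. B (?t (Suc i)) \<omega> - B (?t i) \<omega>) \<in> borel_measurable N"
      using ind that by (auto simp: indep_vars_def)
    have d: "?t (Suc i) - ?t i = 1 / Suc m"
      by (simp add: diff_divide_distrib[symmetric])
    have "distr N borel (X i) = distr (distr N borel (\<lambda>\<omega>. B (?t (Suc i)) \<omega> - B (?t i) \<omega>)) borel (\<lambda>x. \<sigma> * x)"
      using rv by (subst distr_distr) (auto simp: X_def o_def cong: distr_cong)
    also have "distr N borel (\<lambda>\<omega>. B (?t (Suc i)) \<omega> - B (?t i) \<omega>) = normal_law 0 (?t (Suc i) - ?t i)"
      using that by (intro incr) (auto simp: divide_strict_right_mono divide_le_eq_1 simp del: of_nat_Suc)
    also have "distr \<dots> borel (\<lambda>x. \<sigma> * x) = normal_law 0 (\<sigma>\<^sup>2 / Suc m)"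
      unfolding d by (subst distr_scale_normal_law) simp_all
    finally show ?thesis .
  qed
  have "(gauss_step (\<sigma>\<^sup>2 / Suc m) ^^ Suc m) \<psi> 0 0
    = (\<integral>\<omega>. \<psi> (\<Sum>i<Suc m. X i \<omega>) (running_max (\<lambda>i. X i \<omega>) (Suc m)) \<partial>N)"
    by (rule gauss_step_iterates[OF _ indX lawX _ \<psi>, symmetric]) auto
  also have "\<dots> = (\<integral>\<omega>. \<psi> (\<sigma> * B 1 \<omega>) (\<sigma> * Max ((\<lambda>i. B (?t i) \<omega>) ` {..Suc m})) \<partial>N)"
  proof (intro Bochner_Integration.integral_cong refl)
    fix \<omega> assume w: "\<omega> \<in> space N"
    define y where "y i = \<sigma> * B (?t i) \<omega>" for i
    have y0: "y 0 = 0" using B0[OF w] by (simp add: y_def)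
    have X: "X i \<omega> = y (Suc i) - y i" for i
      unfolding X_def y_def by (rule right_diff_distrib)
    have "Max (y ` {..Suc m}) = \<sigma> * Max ((\<lambda>i. B (?t i) \<omega>) ` {..Suc m})"
      using mono_Max_commute[of "\<lambda>x. \<sigma> * x" "(\<lambda>i. B (?t i) \<omega>) ` {..Suc m}"] \<sigma>
      by (simp add: image_image y_def[abs_def] mono_def mult_left_mono del: of_nat_Suc)
    moreover have "y (Suc m) = \<sigma> * B 1 \<omega>" by (simp add: y_def del: of_nat_Suc)
    ultimately show "\<psi> (\<Sum>i<Suc m. X i \<omega>) (running_max (\<lambda>i. X i \<omega>) (Suc m))
      = \<psi> (\<sigma> * B 1 \<omega>) (\<sigma> * Max ((\<lambda>i. B (?t i) \<omega>) ` {..Suc m}))"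
      using running_max_telescope[of y "\<lambda>i. X i \<omega>" "Suc m", OF y0 X] by (simp only:)
  qed
  finally show ?thesis .
qed

lemma gauss_step_tendsto_brownian:
  assumes BM: "standard_brownian_motion N B" and \<sigma>: "0 \<le> \<sigma>" and \<psi>: "bdd_lip C L \<psi>"
  shows "(\<lambda>m. (gauss_step (\<sigma>\<^sup>2 / Suc m) ^^ Suc m) \<psi> 0 0)
    \<longlonglongrightarrow> (\<integral>\<omega>. \<psi> (\<sigma> * B 1 \<omega>) (\<sigma> * (SUP t\<in>{0..1}. B t \<omega>)) \<partial>N)"
  unfolding gauss_step_brownian_grid[OF BM \<sigma> \<psi>]
proof (rule integral_dominated_convergence[where w = "\<lambda>_. \<bar>C\<bar>"])
  interpret prob_space N using BM by (simp add: standard_brownian_motion_def)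
  have B [measurable]: "B t \<in> borel_measurable N" if "t \<in> {0..1}" for t
    using BM that by (simp add: standard_brownian_motion_def)
  have [measurable]: "B 1 \<in> borel_measurable N" by (rule B) simp
  note standard_brownian_motion_sup_measurable[OF BM, measurable]
  show "(\<lambda>\<omega>. \<psi> (\<sigma> * B 1 \<omega>) (\<sigma> * (SUP t\<in>{0..1}. B t \<omega>))) \<in> borel_measurable N"
    by (intro bdd_lip_measurable[OF \<psi>]) measurable
  show "integrable N (\<lambda>_. \<bar>C\<bar>)" by simp
  show "AE \<omega> in N. (\<lambda>m. \<psi> (\<sigma> * B 1 \<omega>) (\<sigma> * Max ((\<lambda>i. B (real i / real (Suc m)) \<omega>) ` {..Suc m})))
      \<longlonglongrightarrow> \<psi> (\<sigma> * B 1 \<omega>) (\<sigma> * (SUP t\<in>{0..1}. B t \<omega>))"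
  proof (rule AE_I2)
    fix \<omega> assume "\<omega> \<in> space N"
    then have "continuous_on {0..1} (\<lambda>t. B t \<omega>)" using BM by (simp add: standard_brownian_motion_def)
    from grid_max_tendsto_sup[OF this]
    have "(\<lambda>m. (\<sigma> * B 1 \<omega>, \<sigma> * Max ((\<lambda>i. B (real i / real (Suc m)) \<omega>) ` {..Suc m})))
      \<longlonglongrightarrow> (\<sigma> * B 1 \<omega>, \<sigma> * (SUP t\<in>{0..1}. B t \<omega>))"
      by (intro tendsto_intros)
    from continuous_on_tendsto_compose[OF bdd_lip_continuous[OF \<psi>] this]
    show "(\<lambda>m. \<psi> (\<sigma> * B 1 \<omega>) (\<sigma> * Max ((\<lambda>i. B (real i / real (Suc m)) \<omega>) ` {..Suc m})))
      \<longlonglongrightarrow> \<psi> (\<sigma> * B 1 \<omega>) (\<sigma> * (SUP t\<in>{0..1}. B t \<omega>))"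
      by simp
  qed
  fix m
  have "B (real i / real (Suc m)) \<in> borel_measurable N" if "i \<le> Suc m" for i
    using that by (intro B) (simp add: divide_le_eq_1 del: of_nat_Suc)
  then have "(\<lambda>\<omega>. Max ((\<lambda>i. B (real i / real (Suc m)) \<omega>) ` {..Suc m})) \<in> borel_measurable N"
    by (intro borel_measurable_Max) auto
  then show "(\<lambda>\<omega>. \<psi> (\<sigma> * B 1 \<omega>) (\<sigma> * Max ((\<lambda>i. B (real i / real (Suc m)) \<omega>) ` {..Suc m}))) \<in> borel_measurable N"
    by (intro bdd_lip_measurable[OF \<psi>] borel_measurable_times) auto
  have "\<bar>\<psi> s g\<bar> \<le> C" for s g using \<psi> by (simp add: bdd_lip_def)
  then show "AE \<omega> in N. norm (\<psi> (\<sigma> * B 1 \<omega>) (\<sigma> * Max ((\<lambda>i. B (real i / real (Suc m)) \<omega>) ` {..Suc m}))) \<le> \<bar>C\<bar>"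
    by (intro AE_I2) (metis abs_ge_self order_trans real_norm_def)
qed

section \<open>Symmetric chains: comparison with a grid\<close>

primrec grid_max :: "nat \<Rightarrow> nat \<Rightarrow> letter list \<Rightarrow> real" where
  "grid_max N 0 w = 0"
| "grid_max N (Suc j) w = max (grid_max N j w) (walk_end (take (N * Suc j) w))"

lemma grid_max_append:
  "N * j \<le> length u \<Longrightarrow> grid_max N j (u @ v) = grid_max N j u"
  by (induction j) auto

lemma walk_end_take_le_max: "walk_end (take k w) \<le> walk_max w"
  using walk_max_append[of "take k w" "drop k w"] walk_end_le_max[of "take k w"] by simp

lemma grid_max_le_walk_max: "grid_max N j w \<le> walk_max w"
  by (induction j) (simp_all add: walk_end_take_le_max)

lemma walk_end_le_grid_max: "length u = N * j \<Longrightarrow> walk_end u \<le> grid_max N j u"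
  by (cases j) auto

context mixing_chain
begin

lemma expectation_word_law_append:
  fixes h :: "letter list \<Rightarrow> real"
  shows "measure_pmf.expectation (word_law (n + k) z) h =
    measure_pmf.expectation (word_law n z)
      (\<lambda>u. measure_pmf.expectation (word_law k (last (z # u))) (\<lambda>v. h (u @ v)))"
  unfolding word_law_append
  by (simp add: pmf_expectation_bind[of "set_pmf (word_law n z)"]
      integral_measure_pmf[of "set_pmf (word_law n z)" "word_law n z"])

lemma expectation_word_law_cong:
  fixes f g :: "letter list \<Rightarrow> real"
  assumes "\<And>w. length w = n \<Longrightarrow> f w = g w"
  shows "measure_pmf.expectation (word_law n z) f = measure_pmf.expectation (word_law n z) g"
  using assms set_word_law by (intro integral_cong_AE) (auto intro!: AE_pmfI)

lemma expectation_word_law_mono: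
  fixes f g :: "letter list \<Rightarrow> real"
  assumes "\<And>w. length w = n \<Longrightarrow> f w \<le> g w"
  shows "measure_pmf.expectation (word_law n z) f \<le> measure_pmf.expectation (word_law n z) g"
  using assms set_word_law by (intro integral_mono_AE) (auto intro!: AE_pmfI)

lemma expectation_word_law_diff_le:
  fixes f g h :: "letter list \<Rightarrow> real"
  assumes "\<And>w. length w = n \<Longrightarrow> \<bar>f w - g w\<bar> \<le> h w"
  shows "\<bar>measure_pmf.expectation (word_law n z) f - measure_pmf.expectation (word_law n z) g\<bar>
    \<le> measure_pmf.expectation (word_law n z) h"
proof -
  have "\<bar>measure_pmf.expectation (word_law n z) f - measure_pmf.expectation (word_law n z) g\<bar>
    = \<bar>measure_pmf.expectation (word_law n z) (\<lambda>w. f w - g w)\<bar>"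
    by (subst Bochner_Integration.integral_diff) auto
  also have "\<dots> \<le> measure_pmf.expectation (word_law n z) (\<lambda>w. \<bar>f w - g w\<bar>)"
    using integral_norm_bound[of "measure_pmf (word_law n z)" "\<lambda>w. f w - g w"] by simp
  also have "\<dots> \<le> measure_pmf.expectation (word_law n z) h"
    by (rule expectation_word_law_mono) (rule assms)
  finally show ?thesis .
qed

text \<open>For \<open>a = b\<close> the walk has no drift. Its increments over a block of \<open>n div m\<close> letters are, after
  division by \<open>sqrt n\<close>, asymptotically normal with the \<open>m\<close>-th part of the variance; the factor 4 comes
  from \<open>step = 2 * centred\<close>.\<close>

lemma block_weak_limit:
  assumes ab: "a = b" and m: "0 < m"
  shows "weak_conv_m (\<lambda>n. distr (word_law (n div m) z) borel (\<lambda>w. walk_end w / sqrt n))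
    (normal_law 0 (4 * asym_var / m))"
proof (rule levy_continuity)
  show "real_distribution (distr (word_law (n div m) z) borel (\<lambda>w. walk_end w / sqrt n))" for n
    by (rule prob_space.real_distribution_distr) (auto intro: prob_space_measure_pmf)
  have v: "0 \<le> 4 * asym_var / m" using asym_var_nonneg by simp
  then show "real_distribution (normal_law 0 (4 * asym_var / m))" by simp
  fix u
  have "(\<lambda>n. measure_pmf.expectation (word_law (n div m) z) (\<lambda>w. iexp (2 * u / sqrt n * centred_sum w)))
      \<longlonglongrightarrow> of_real (exp (- (asym_var * (4 * u\<^sup>2 / m) / 2)))"
  proof (rule char_centred_sum_tendsto)
    show "(\<lambda>n. 2 * u / sqrt (real n)) \<longlonglongrightarrow> 0" by real_asymp
    have dm: "real (n div m) = (real n - real (n mod m)) / m" for n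
      using m by (simp add: field_simps flip: of_nat_add of_nat_mult)
    have "(\<lambda>n. real (n mod m) / real n) \<longlonglongrightarrow> 0"
    proof (rule Lim_null_comparison[OF always_eventually])
      show "\<forall>n. norm (real (n mod m) / real n) \<le> real m / real n"
        using m by (intro allI) (simp add: divide_right_mono less_imp_le)
      show "(\<lambda>n. real m / real n) \<longlonglongrightarrow> 0" by real_asymp
    qed
    then have lim: "(\<lambda>n. 4 * u\<^sup>2 / m * (1 - real (n mod m) / real n)) \<longlonglongrightarrow> 4 * u\<^sup>2 / m * (1 - 0)"
      by (intro tendsto_intros)
    have "eventually (\<lambda>n. 4 * u\<^sup>2 / m * (1 - real (n mod m) / real n) = real (n div m) * (2 * u / sqrt n)\<^sup>2) sequentially"
      using eventually_gt_at_top[of 0]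
    proof eventually_elim
      case (elim n)
      then show ?case using m unfolding dm
        by (simp add: power_divide power_mult_distrib) (simp add: field_simps)
    qed
    from Lim_transform_eventually[OF lim this]
    show "(\<lambda>n. real (n div m) * (2 * u / sqrt n)\<^sup>2) \<longlonglongrightarrow> 4 * u\<^sup>2 / m" by simp
  qed
  moreover have "char (distr (word_law (n div m) z) borel (\<lambda>w. walk_end w / sqrt n)) u
    = measure_pmf.expectation (word_law (n div m) z) (\<lambda>w. iexp (2 * u / sqrt n * centred_sum w))" for n
    using ab by (subst char_distr) (simp_all add: walk_end_eq_centred_sum mult_ac)
  ultimately show "(\<lambda>n. char (distr (word_law (n div m) z) borel (\<lambda>w. walk_end w / sqrt n)) u)
      \<longlonglongrightarrow> char (normal_law 0 (4 * asym_var / m)) u"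
    unfolding char_normal_law[OF v] by (simp add: mult_ac)
qed

text \<open>The blocks are not independent, but given the past a block depends only on one letter, and its limit
  law does not depend on that letter. Averaging the last block out therefore replaces the test function by its
  \<open>gauss_step\<close>, up to an error that is uniform in the past because the test function is bounded and
  Lipschitz; the induction continues with this new test function.\<close>

lemma block_grid_limit:
  assumes ab: "a = b" and m: "0 < m" and "bdd_lip C L \<psi>"
  shows "(\<lambda>n. measure_pmf.expectation (word_law (n div m * j) z)
      (\<lambda>w. \<psi> (walk_end w / sqrt n) (grid_max (n div m) j w / sqrt n)))
    \<longlonglongrightarrow> (gauss_step (4 * asym_var / m) ^^ j) \<psi> 0 0"
  using assms(3)
proof (induction j arbitrary: \<psi>)
  case 0
  then show ?case by simp
next
  case (Suc j)
  note \<psi> = Suc.prems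
  let ?v = "4 * asym_var / m"
  have v: "0 \<le> ?v" using asym_var_nonneg by simp
  let ?\<mu> = "\<lambda>z n. distr (word_law (n div m) z) borel (\<lambda>w. walk_end w / sqrt n)"
  let ?A = "\<lambda>n. measure_pmf.expectation (word_law (n div m * Suc j) z)
      (\<lambda>w. \<psi> (walk_end w / sqrt n) (grid_max (n div m) (Suc j) w / sqrt n))"
  let ?B = "\<lambda>n. measure_pmf.expectation (word_law (n div m * j) z)
      (\<lambda>w. gauss_step ?v \<psi> (walk_end w / sqrt n) (grid_max (n div m) j w / sqrt n))"
  have B: "?B \<longlonglongrightarrow> (gauss_step ?v ^^ j) (gauss_step ?v \<psi>) 0 0"
    by (rule Suc.IH[OF bdd_lip_gauss_step[OF v \<psi>]])
  have "(\<lambda>n. ?A n - ?B n) \<longlonglongrightarrow> 0"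
  proof (rule tendstoI)
    fix \<epsilon> :: real assume \<epsilon>: "0 < \<epsilon>"
    let ?U = "\<lambda>z n. \<forall>h :: real \<Rightarrow> real. (\<forall>x. \<bar>h x\<bar> \<le> C) \<longrightarrow> (\<forall>x y. \<bar>h x - h y\<bar> \<le> L * \<bar>x - y\<bar>) \<longrightarrow>
      h \<in> borel_measurable borel \<longrightarrow> \<bar>integral\<^sup>L (?\<mu> z n) h - integral\<^sup>L (normal_law 0 ?v) h\<bar> < \<epsilon> / 2"
    have ev: "eventually (?U z) sequentially" for z
    proof (rule weak_conv_uniform_bdd_lip[OF _ _ block_weak_limit[OF ab m]])
      show "real_distribution (?\<mu> z n)" for n
        by (rule prob_space.real_distribution_distr) (auto intro: prob_space_measure_pmf)
    qed (use v \<epsilon> in simp_all)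
    have "eventually (\<lambda>n. ?U Alpha1 n \<and> ?U Alpha2 n) sequentially"
      by (intro eventually_conj ev)
    then show "eventually (\<lambda>n. dist (?A n - ?B n) 0 < \<epsilon>) sequentially"
    proof (rule eventually_mono)
      fix n assume U12: "?U Alpha1 n \<and> ?U Alpha2 n"
      have U: "?U z n" for z using U12 by (cases z) blast+
      define N where "N = n div m"
      let ?f = "\<lambda>w. \<psi> (walk_end w / sqrt n) (grid_max N (Suc j) w / sqrt n)"
      have "?A n = measure_pmf.expectation (word_law (N * j + N) z) ?f"
        by (simp add: N_def add.commute)
      also have "\<dots> = measure_pmf.expectation (word_law (N * j) z)
          (\<lambda>u. measure_pmf.expectation (word_law N (last (z # u))) (\<lambda>v. ?f (u @ v)))"
        by (rule expectation_word_law_append)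
      finally have A: "?A n = \<dots>" .
      have "\<bar>?A n - ?B n\<bar> \<le> measure_pmf.expectation (word_law (N * j) z) (\<lambda>_. \<epsilon> / 2)"
        unfolding A unfolding N_def[symmetric]
      proof (rule expectation_word_law_diff_le)
        fix u :: "letter list" assume len: "length u = N * j"
        define s g where "s = walk_end u / sqrt n" and "g = grid_max N j u / sqrt n"
        define h where "h x = \<psi> (s + x) (max g (s + x))" for x
        have hm: "h \<in> borel_measurable borel"
          unfolding h_def by (intro bdd_lip_measurable[OF \<psi>]) measurable
        have "measure_pmf.expectation (word_law N (last (z # u))) (\<lambda>v. ?f (u @ v))
            = measure_pmf.expectation (word_law N (last (z # u))) (\<lambda>v. h (walk_end v / sqrt n))"
        proof (rule expectation_word_law_cong)
          fix v :: "letter list" assume "length v = N"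
          with len have "take (N * Suc j) (u @ v) = u @ v" by simp
          then have "grid_max N (Suc j) (u @ v) = max (grid_max N j u) (walk_end u + walk_end v)"
            using len by (simp add: grid_max_append del: take_append)
          then show "?f (u @ v) = h (walk_end v / sqrt n)"
            by (simp add: h_def s_def g_def add_divide_distrib max_divide_distrib_right)
        qed
        also have "\<dots> = integral\<^sup>L (?\<mu> (last (z # u)) n) h"
          using hm by (subst integral_distr) (auto simp: N_def)
        finally have 1: "measure_pmf.expectation (word_law N (last (z # u))) (\<lambda>v. ?f (u @ v))
          = integral\<^sup>L (?\<mu> (last (z # u)) n) h" .
        have 2: "gauss_step ?v \<psi> s g = integral\<^sup>L (normal_law 0 ?v) h"
          unfolding gauss_step_def h_def[abs_def] ..
        have "\<forall>x. \<bar>h x\<bar> \<le> C" using \<psi> by (simp add: h_def bdd_lip_def)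
        moreover have "\<forall>x y. \<bar>h x - h y\<bar> \<le> L * \<bar>x - y\<bar>"
          using bdd_lip_shift[OF \<psi>, of s _ g s _ g] by (simp add: h_def)
        ultimately have "\<bar>integral\<^sup>L (?\<mu> (last (z # u)) n) h - integral\<^sup>L (normal_law 0 ?v) h\<bar> < \<epsilon> / 2"
          using U hm by blast
        then show "\<bar>measure_pmf.expectation (word_law N (last (z # u))) (\<lambda>v. ?f (u @ v))
            - gauss_step ?v \<psi> (walk_end u / sqrt n) (grid_max N j u / sqrt n)\<bar> \<le> \<epsilon> / 2"
          unfolding 1 s_def[symmetric] g_def[symmetric] 2 by simp
      qed
      then show "dist (?A n - ?B n) 0 < \<epsilon>" using \<epsilon> by simp
    qed
  qed
  from tendsto_add[OF this B] show ?case by (simp add: funpow_swap1)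
qed

text \<open>If no block rises by \<open>l\<close> above its starting height, then no point of the walk is more than \<open>l\<close> above
  the preceding grid point, hence above the grid maximum.\<close>

lemma prob_grid_gap:
  assumes p: "\<And>z. measure_pmf.prob (word_law N z) {w. l \<le> walk_max w} \<le> p" and l: "0 \<le> l"
  shows "measure_pmf.prob (word_law (N * j) z) {w. grid_max N j w + l < walk_max w} \<le> j * p"
proof (induction j)
  case 0
  show ?case using l by (simp add: measure_return_pmf)
next
  case (Suc j)
  let ?bad = "\<lambda>j. {w. grid_max N j w + l < walk_max w}"
  have "measure_pmf.prob (word_law (N * Suc j) z) (?bad (Suc j))
      = measure_pmf.expectation (word_law (N * j + N) z) (indicator (?bad (Suc j)))"
    by (simp add: add.commute)
  also have "\<dots> = measure_pmf.expectation (word_law (N * j) z)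
      (\<lambda>u. measure_pmf.expectation (word_law N (last (z # u))) (\<lambda>v. indicator (?bad (Suc j)) (u @ v)))"
    by (rule expectation_word_law_append)
  also have "\<dots> \<le> measure_pmf.expectation (word_law (N * j) z) (\<lambda>u. indicator (?bad j) u + p)"
  proof (rule expectation_word_law_mono)
    fix u :: "letter list" assume len: "length u = N * j"
    have "measure_pmf.expectation (word_law N (last (z # u))) (\<lambda>v. indicator (?bad (Suc j)) (u @ v) :: real)
      \<le> measure_pmf.expectation (word_law N (last (z # u)))
          (\<lambda>v. indicator (?bad j) u + indicator {w. l \<le> walk_max w} v)"
    proof (rule expectation_word_law_mono)
      fix v :: "letter list" assume "length v = N"
      with len have "take (N * Suc j) (u @ v) = u @ v" by simp
      then have g: "grid_max N (Suc j) (u @ v) = max (grid_max N j u) (walk_end u + walk_end v)"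
        using len by (simp add: grid_max_append del: take_append)
      have "u \<in> ?bad j \<or> l \<le> walk_max v" if "u @ v \<in> ?bad (Suc j)"
        using that walk_end_le_grid_max[OF len] unfolding mem_Collect_eq g walk_max_append by auto
      then show "indicator (?bad (Suc j)) (u @ v)
          \<le> (indicator (?bad j) u + indicator {w. l \<le> walk_max w} v :: real)"
        by (auto simp: indicator_def)
    qed
    also have "\<dots> = indicator (?bad j) u + measure_pmf.prob (word_law N (last (z # u))) {w. l \<le> walk_max w}"
      by (subst Bochner_Integration.integral_add) auto
    also have "\<dots> \<le> indicator (?bad j) u + p" by (intro add_left_mono p)
    finally show "measure_pmf.expectation (word_law N (last (z # u))) (\<lambda>v. indicator (?bad (Suc j)) (u @ v))
      \<le> indicator (?bad j) u + p" .
  qed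
  also have "\<dots> = measure_pmf.prob (word_law (N * j) z) (?bad j) + p"
    by (subst Bochner_Integration.integral_add) auto
  also have "\<dots> \<le> Suc j * p" using Suc by (simp add: algebra_simps)
  finally show ?case .
qed

text \<open>Three errors: the at most \<open>m\<close> letters after the last grid point, the gap between maximum and grid
  maximum when it is below \<open>\<delta> * sqrt n\<close>, and the probability that this gap is larger. The last one is \<open>m\<close>
  times a tail that decays exponentially in \<open>m\<close> as \<open>n\<close> grows; a second-moment bound would only give
  a tail of order \<open>1 / m\<close>, which the factor \<open>m\<close> would cancel.\<close>

lemma grid_approximation:
  fixes \<phi> :: "real \<Rightarrow> real"
  assumes ab: "a = b" and m: "0 < m" and n: "0 < n" and \<delta>: "0 < \<delta>"
    and bdd: "\<And>x. \<bar>\<phi> x\<bar> \<le> 1" and lip: "\<And>x y. \<bar>\<phi> x - \<phi> y\<bar> \<le> L * \<bar>x - y\<bar>" and L: "0 \<le> L"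
  shows "\<bar>measure_pmf.expectation (word_law n z) (\<lambda>w. \<phi> ((top_row w - n * (1 / 2)) / sqrt n))
      - measure_pmf.expectation (word_law (n div m * m) z)
          (\<lambda>w. \<phi> (grid_max (n div m) m w / sqrt n - walk_end w / sqrt n / 2))\<bar>
    \<le> L * (\<delta> + 2 * real m / sqrt n) + 2 * (m * exp (16 * a\<^sup>2 * \<delta> * m * \<bar>corrector\<bar> / sqrt n - 2 * a\<^sup>2 * \<delta>\<^sup>2 * m))"
proof -
  define N r where "N = n div m" and "r = n mod m"
  have nr: "n = N * m + r" and r: "r < m" using m by (simp_all add: N_def r_def)
  have sq: "0 < sqrt n" using n by simp
  let ?p = "exp (16 * a\<^sup>2 * \<delta> * m * \<bar>corrector\<bar> / sqrt n - 2 * a\<^sup>2 * \<delta>\<^sup>2 * m)"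
  have a: "0 < a" using ab ab_pos by simp
  have tail: "measure_pmf.prob (word_law N z) {w. \<delta> * sqrt n \<le> walk_max w} \<le> ?p" for z
  proof -
    \<comment> \<open>The minimiser of the quadratic and linear terms of the tail bound for a block of length \<open>n / m\<close> and level \<open>\<delta> * sqrt n\<close>.\<close>
    define \<theta> where "\<theta> = 8 * a\<^sup>2 * \<delta> * m / sqrt n"
    have \<theta>: "0 \<le> \<theta>" using \<delta> by (simp add: \<theta>_def)
    have "N * (\<theta>\<^sup>2 / (8 * (a + b)\<^sup>2)) \<le> 2 * a\<^sup>2 * \<delta>\<^sup>2 * m"
    proof -
      have "\<theta>\<^sup>2 / (8 * (a + b)\<^sup>2) = 2 * a\<^sup>2 * \<delta>\<^sup>2 * m * (m / n)"
        using a n unfolding ab[symmetric] \<theta>_def by (simp add: power_divide power_mult_distrib power2_eq_square)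
      then have "N * (\<theta>\<^sup>2 / (8 * (a + b)\<^sup>2)) = 2 * a\<^sup>2 * \<delta>\<^sup>2 * m * (real (N * m) / n)"
        by simp
      also have "\<dots> \<le> 2 * a\<^sup>2 * \<delta>\<^sup>2 * m * 1"
        using nr n by (intro mult_left_mono) (auto simp: divide_le_eq_1 simp del: of_nat_mult)
      finally show ?thesis by simp
    qed
    moreover have "\<theta> * (\<delta> * sqrt n / 2) = 4 * a\<^sup>2 * \<delta>\<^sup>2 * m"
      using sq by (simp add: \<theta>_def power2_eq_square)
    moreover have "2 * \<bar>\<theta> * corrector\<bar> = 16 * a\<^sup>2 * \<delta> * m * \<bar>corrector\<bar> / sqrt n"
      using \<theta> by (simp add: abs_mult) (simp add: \<theta>_def)
    ultimately have "2 * \<bar>\<theta> * corrector\<bar> + N * (\<theta>\<^sup>2 / (8 * (a + b)\<^sup>2)) - \<theta> * (\<delta> * sqrt n / 2)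
        \<le> 16 * a\<^sup>2 * \<delta> * m * \<bar>corrector\<bar> / sqrt n - 2 * a\<^sup>2 * \<delta>\<^sup>2 * m"
      by linarith
    then show ?thesis
      by (intro order_trans[OF walk_max_tail[OF ab \<theta>]]) simp
  qed
  let ?bad = "{w. grid_max N m w + \<delta> * sqrt n < walk_max w}"
  let ?g = "\<lambda>w. \<phi> (grid_max N m w / sqrt n - walk_end w / sqrt n / 2)"
  let ?t = "\<lambda>w. \<phi> ((top_row w - n * (1 / 2)) / sqrt n)"
  have "measure_pmf.expectation (word_law n z) ?t
      = measure_pmf.expectation (word_law (N * m + r) z) ?t"
    using nr by simp
  also have "\<dots> = measure_pmf.expectation (word_law (N * m) z)
      (\<lambda>u. measure_pmf.expectation (word_law r (last (z # u))) (\<lambda>v. ?t (u @ v)))"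
    by (rule expectation_word_law_append)
  finally have E: "measure_pmf.expectation (word_law n z) ?t = \<dots>" .
  have "\<bar>measure_pmf.expectation (word_law n z) ?t - measure_pmf.expectation (word_law (N * m) z) ?g\<bar>
      \<le> measure_pmf.expectation (word_law (N * m) z) (\<lambda>u. L * (\<delta> + 2 * real m / sqrt n) + 2 * indicator ?bad u)"
    unfolding E
  proof (rule expectation_word_law_diff_le)
    fix u :: "letter list" assume lu: "length u = N * m"
    have "\<bar>measure_pmf.expectation (word_law r (last (z # u))) (\<lambda>v. ?t (u @ v))
        - measure_pmf.expectation (word_law r (last (z # u))) (\<lambda>v. ?g u)\<bar>
      \<le> measure_pmf.expectation (word_law r (last (z # u))) (\<lambda>_. L * (\<delta> + 2 * real m / sqrt n) + 2 * indicator ?bad u)"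
    proof (rule expectation_word_law_diff_le)
      fix v :: "letter list" assume lv: "length v = r"
      show "\<bar>?t (u @ v) - ?g u\<bar> \<le> L * (\<delta> + 2 * real m / sqrt n) + 2 * indicator ?bad u"
      proof (cases "u \<in> ?bad")
        case True
        have "0 \<le> L * (\<delta> + 2 * real m / sqrt n)" using L \<delta> by simp
        with True bdd[of "(top_row (u @ v) - n * (1 / 2)) / sqrt n"]
          bdd[of "grid_max N m u / sqrt n - walk_end u / sqrt n / 2"]
        show ?thesis by simp
      next
        case False
        have len: "real (length (u @ v)) = real n" using nr lu lv by simp
        have t: "top_row (u @ v) - n * (1 / 2) = walk_max (u @ v) - walk_end (u @ v) / 2"
          unfolding top_row_def len by (simp add: diff_divide_distrib)
        have Mv: "0 \<le> walk_max v" "walk_max v \<le> m" "\<bar>walk_end v\<bar> \<le> m"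
          using walk_max_le_length[of v] abs_walk_end_le[of v] lv r by auto
        have dev: "\<bar>(walk_max (u @ v) - walk_end (u @ v) / 2) - (grid_max N m u - walk_end u / 2)\<bar>
            \<le> \<delta> * sqrt n + 2 * m"
          using False Mv walk_end_le_max[of u] grid_max_le_walk_max[of N m u]
          by (simp add: walk_max_append max_def field_simps) linarith
        have "\<bar>(top_row (u @ v) - n * (1 / 2)) / sqrt n - (grid_max N m u / sqrt n - walk_end u / sqrt n / 2)\<bar>
            \<le> (\<delta> * sqrt n + 2 * m) / sqrt n"
        proof -
          have "(top_row (u @ v) - n * (1 / 2)) / sqrt n - (grid_max N m u / sqrt n - walk_end u / sqrt n / 2)
            = ((walk_max (u @ v) - walk_end (u @ v) / 2) - (grid_max N m u - walk_end u / 2)) / sqrt n"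
            unfolding t by (simp add: diff_divide_distrib)
          with dev show ?thesis using sq
            by (simp only: abs_divide abs_of_pos) (intro divide_right_mono, simp_all)
        qed
        also have "\<dots> = \<delta> + 2 * real m / sqrt n" using sq by (simp add: add_divide_distrib)
        finally have "\<bar>?t (u @ v) - ?g u\<bar> \<le> L * (\<delta> + 2 * real m / sqrt n)"
          using lip L mult_left_mono order_trans by blast
        then show ?thesis using False by simp
      qed
    qed
    then show "\<bar>measure_pmf.expectation (word_law r (last (z # u))) (\<lambda>v. ?t (u @ v)) - ?g u\<bar>
      \<le> L * (\<delta> + 2 * real m / sqrt n) + 2 * indicator ?bad u" by simp
  qed
  also have "\<dots> = L * (\<delta> + 2 * real m / sqrt n) + 2 * measure_pmf.prob (word_law (N * m) z) ?bad"
    by (subst Bochner_Integration.integral_add) auto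
  also have "\<dots> \<le> L * (\<delta> + 2 * real m / sqrt n) + 2 * (m * ?p)"
    using \<delta> by (intro add_left_mono mult_left_mono prob_grid_gap tail) auto
  finally show ?thesis by (simp add: N_def)
qed

text \<open>The number \<open>m\<close> of blocks is fixed first, so large that the grid errors on both the discrete and the
  Brownian side are small; then \<open>n\<close> tends to infinity.\<close>

lemma expectation_top_row_symmetric:
  fixes \<phi> :: "real \<Rightarrow> real"
  assumes ab: "a = b" and BM: "standard_brownian_motion N B"
    and bdd: "\<And>x. \<bar>\<phi> x\<bar> \<le> 1" and lip: "\<And>x y. \<bar>\<phi> x - \<phi> y\<bar> \<le> L * \<bar>x - y\<bar>" and L: "0 \<le> L"
  shows "(\<lambda>n. measure_pmf.expectation (word_law n z) (\<lambda>w. \<phi> ((top_row w - n * (1 / 2)) / sqrt n)))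
    \<longlonglongrightarrow> (\<integral>\<omega>. \<phi> (sqrt ((1 - a) / a) * (- (1 / 2) * B 1 \<omega> + (SUP t\<in>{0..1}. B t \<omega>))) \<partial>N)"
proof -
  define \<sigma> where "\<sigma> = sqrt ((1 - a) / a)"
  have a: "0 < a" using ab ab_pos by simp
  have \<sigma>: "0 \<le> \<sigma>" using a a01 by (simp add: \<sigma>_def)
  have \<sigma>2: "\<sigma>\<^sup>2 = 4 * asym_var"
    unfolding \<sigma>_def asym_var_def unfolding ab[symmetric]
    using a a01 by (simp add: power3_eq_cube field_simps)
  define \<psi> where "\<psi> s g = \<phi> (g - s / 2)" for s g
  have \<psi>: "bdd_lip 1 (L * 2) \<psi>"
    unfolding bdd_lip_def
  proof (intro conjI allI)
    fix s g s' g' :: real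
    have "\<bar>(g - s / 2) - (g' - s' / 2)\<bar> \<le> 2 * max \<bar>s - s'\<bar> \<bar>g - g'\<bar>"
      by (auto simp: max_def abs_if field_simps)
    then have "L * \<bar>(g - s / 2) - (g' - s' / 2)\<bar> \<le> L * (2 * max \<bar>s - s'\<bar> \<bar>g - g'\<bar>)"
      using L by (rule mult_left_mono)
    with lip[of "g - s / 2" "g' - s' / 2"]
    show "\<bar>\<psi> s g - \<psi> s' g'\<bar> \<le> L * 2 * max \<bar>s - s'\<bar> \<bar>g - g'\<bar>" by (simp add: \<psi>_def)
  qed (use L bdd in \<open>simp_all add: \<psi>_def\<close>)
  define E where "E n = measure_pmf.expectation (word_law n z) (\<lambda>w. \<phi> ((top_row w - n * (1 / 2)) / sqrt n))" for n
  define G where "G m = (gauss_step (\<sigma>\<^sup>2 / m) ^^ m) \<psi> 0 0" for m :: nat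
  define I where "I = (\<integral>\<omega>. \<psi> (\<sigma> * B 1 \<omega>) (\<sigma> * (SUP t\<in>{0..1}. B t \<omega>)) \<partial>N)"
  have GI: "(\<lambda>m. G (Suc m)) \<longlonglongrightarrow> I"
    unfolding G_def I_def by (rule gauss_step_tendsto_brownian[OF BM \<sigma> \<psi>])
  have "E \<longlonglongrightarrow> I"
  proof (rule tendstoI)
    fix \<epsilon> :: real assume \<epsilon>: "0 < \<epsilon>"
    define \<delta> where "\<delta> = \<epsilon> / (4 * (L + 1))"
    have \<delta>: "0 < \<delta>" using \<epsilon> L by (simp add: \<delta>_def)
    have L\<delta>: "L * \<delta> \<le> \<epsilon> / 4"
      using \<epsilon> L by (simp add: \<delta>_def divide_simps)
    define c where "c = 2 * a\<^sup>2 * \<delta>\<^sup>2"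
    have c: "0 < c" using a \<delta> by (simp add: c_def)
    have "(\<lambda>m. 2 * (real (Suc m) * exp (- c * real (Suc m)))) \<longlonglongrightarrow> 0"
      using c by real_asymp
    then have "eventually (\<lambda>m. 2 * (real (Suc m) * exp (- c * real (Suc m))) < \<epsilon> / 4) sequentially"
      by (rule order_tendstoD(2)) (use \<epsilon> in simp)
    moreover have "eventually (\<lambda>m. dist (G (Suc m)) I < \<epsilon> / 4) sequentially"
      using GI \<epsilon> by (intro tendstoD) auto
    ultimately have "eventually (\<lambda>m. 2 * (real (Suc m) * exp (- c * real (Suc m))) < \<epsilon> / 4
        \<and> dist (G (Suc m)) I < \<epsilon> / 4) sequentially"
      by (rule eventually_conj)
    then obtain k where k: "2 * (real (Suc k) * exp (- c * real (Suc k))) < \<epsilon> / 4" "dist (G (Suc k)) I < \<epsilon> / 4"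
      using eventually_happens'[OF sequentially_bot] by blast
    define m where "m = Suc k"
    have m: "0 < m" by (simp add: m_def)
    define A where "A n = measure_pmf.expectation (word_law (n div m * m) z)
        (\<lambda>w. \<psi> (walk_end w / sqrt n) (grid_max (n div m) m w / sqrt n))" for n
    have "A \<longlonglongrightarrow> G m"
      unfolding A_def G_def \<sigma>2 by (rule block_grid_limit[OF ab m \<psi>])
    then have evA: "eventually (\<lambda>n. dist (A n) (G m) < \<epsilon> / 4) sequentially"
      using \<epsilon> by (intro tendstoD) auto
    define b' where "b' n = L * (\<delta> + 2 * real m / sqrt n)
        + 2 * (m * exp (16 * a\<^sup>2 * \<delta> * m * \<bar>corrector\<bar> / sqrt n - 2 * a\<^sup>2 * \<delta>\<^sup>2 * m))" for n :: nat
    have "b' \<longlonglongrightarrow> L * (\<delta> + 0) + 2 * (m * exp (0 - 2 * a\<^sup>2 * \<delta>\<^sup>2 * m))"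
    proof -
      have vanish: "(\<lambda>n. x / sqrt (real n)) \<longlonglongrightarrow> 0" for x by real_asymp
      have "(\<lambda>n. L * (\<delta> + p n) + 2 * (m * exp (q n - y))) \<longlonglongrightarrow> L * (\<delta> + 0) + 2 * (m * exp (0 - y))"
        if "p \<longlonglongrightarrow> 0" "q \<longlonglongrightarrow> 0" for p q :: "nat \<Rightarrow> real" and y
        by (intro tendsto_intros that)
      from this[OF vanish vanish] show ?thesis unfolding b'_def .
    qed
    moreover have "L * (\<delta> + 0) + 2 * (m * exp (0 - 2 * a\<^sup>2 * \<delta>\<^sup>2 * m)) < \<epsilon> / 2"
      using L\<delta> k(1) by (simp add: m_def c_def)
    ultimately have evb: "eventually (\<lambda>n. b' n < \<epsilon> / 2) sequentially"
      by (rule order_tendstoD)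
    show "eventually (\<lambda>n. dist (E n) I < \<epsilon>) sequentially"
      using evA evb eventually_gt_at_top[of 0]
    proof eventually_elim
      case (elim n)
      have "\<bar>E n - A n\<bar> \<le> b' n"
        unfolding E_def A_def b'_def \<psi>_def
        by (rule grid_approximation[OF ab m elim(3) \<delta> bdd lip L])
      with elim(1,2) k(2) show ?case
        unfolding m_def[symmetric] dist_real_def by linarith
    qed
  qed
  moreover have "I = (\<integral>\<omega>. \<phi> (sqrt ((1 - a) / a) * (- (1 / 2) * B 1 \<omega> + (SUP t\<in>{0..1}. B t \<omega>))) \<partial>N)"
    unfolding I_def \<psi>_def \<sigma>_def[symmetric] by (simp add: algebra_simps)
  ultimately show ?thesis by (simp add: E_def[abs_def])
qed

text \<open>Cosine and sine are bounded Lipschitz functions, so the previous lemma yields the convergence of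
  characteristic functions.\<close>

lemma char_top_row_symmetric:
  assumes ab: "a = b" and BM: "standard_brownian_motion N B"
  defines "R \<equiv> (\<lambda>\<omega>. sqrt ((1 - a) / a) * (- (1 / 2) * B 1 \<omega> + (SUP t\<in>{0..1}. B t \<omega>)))"
  shows "(\<lambda>n. measure_pmf.expectation (word_law n z) (\<lambda>w. iexp (u * ((top_row w - n * (1 / 2)) / sqrt n))))
    \<longlonglongrightarrow> char (distr N borel R) u" and "real_distribution (distr N borel R)"
proof -
  interpret prob_space N using BM by (simp add: standard_brownian_motion_def)
  have "B 1 \<in> borel_measurable N" using BM by (simp add: standard_brownian_motion_def)
  then have [measurable]: "R \<in> borel_measurable N"
    unfolding R_def using standard_brownian_motion_sup_measurable[OF BM] by measurable
  show "real_distribution (distr N borel R)" by (rule real_distribution_distr) simp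
  have lip: "\<bar>cos (u * x) - cos (u * y)\<bar> \<le> \<bar>u\<bar> * \<bar>x - y\<bar>" "\<bar>sin (u * x) - sin (u * y)\<bar> \<le> \<bar>u\<bar> * \<bar>x - y\<bar>" for x y
  proof -
    have n: "norm (iexp (u * x) - iexp (u * y)) \<le> \<bar>u\<bar> * \<bar>x - y\<bar>"
      using norm_iexp_diff_le[of "u * x" "u * y"] by (simp add: abs_mult flip: right_diff_distrib)
    have "\<bar>cos (u * x) - cos (u * y)\<bar> \<le> norm (iexp (u * x) - iexp (u * y))"
      using abs_Re_le_cmod[of "iexp (u * x) - iexp (u * y)"] by (simp add: Re_exp)
    with n show "\<bar>cos (u * x) - cos (u * y)\<bar> \<le> \<bar>u\<bar> * \<bar>x - y\<bar>" by linarith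
    have "\<bar>sin (u * x) - sin (u * y)\<bar> \<le> norm (iexp (u * x) - iexp (u * y))"
      using abs_Im_le_cmod[of "iexp (u * x) - iexp (u * y)"] by (simp add: Im_exp)
    with n show "\<bar>sin (u * x) - sin (u * y)\<bar> \<le> \<bar>u\<bar> * \<bar>x - y\<bar>" by linarith
  qed
  let ?E = "\<lambda>n \<phi>. measure_pmf.expectation (word_law n z) (\<lambda>w. \<phi> (u * ((top_row w - n * (1 / 2)) / sqrt n)) :: real)"
  have c: "(\<lambda>n. ?E n cos) \<longlonglongrightarrow> (\<integral>\<omega>. cos (u * R \<omega>) \<partial>N)"
    unfolding R_def by (rule expectation_top_row_symmetric[OF ab BM _ lip(1)]) simp_all
  have s: "(\<lambda>n. ?E n sin) \<longlonglongrightarrow> (\<integral>\<omega>. sin (u * R \<omega>) \<partial>N)"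
    unfolding R_def by (rule expectation_top_row_symmetric[OF ab BM _ lip(2)]) simp_all
  have iexp: "iexp x = of_real (cos x) + \<i> * of_real (sin x)" for x
    by (simp add: complex_eq_iff Re_exp Im_exp)
  have E: "measure_pmf.expectation (word_law n z) (\<lambda>w. iexp (u * ((top_row w - n * (1 / 2)) / sqrt n)))
      = of_real (?E n cos) + \<i> * of_real (?E n sin)" for n
    unfolding iexp by (subst Bochner_Integration.integral_add) auto
  have i: "integrable N (\<lambda>\<omega>. complex_of_real (cos (u * R \<omega>)))" "integrable N (\<lambda>\<omega>. \<i> * complex_of_real (sin (u * R \<omega>)))"
    by (rule integrable_const_bound[where B = 1]; simp add: norm_mult)+
  have ch: "char (distr N borel R) u = of_real (\<integral>\<omega>. cos (u * R \<omega>) \<partial>N) + \<i> * of_real (\<integral>\<omega>. sin (u * R \<omega>) \<partial>N)"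
    unfolding char_distr[OF \<open>R \<in> borel_measurable N\<close>] iexp
    by (subst Bochner_Integration.integral_add[OF i]) simp
  show "(\<lambda>n. measure_pmf.expectation (word_law n z) (\<lambda>w. iexp (u * ((top_row w - n * (1 / 2)) / sqrt n))))
    \<longlonglongrightarrow> char (distr N borel R) u"
    unfolding E ch by (intro tendsto_intros c s)
qed

end

section \<open>The limiting shape\<close>

lemma limit_shape_symmetric:
  fixes M :: "'w measure" and N :: "'v measure"
  assumes ch: "two_letter_chain a b" and mc: "markov_chain M X (init_prob a b) (trans_prob a b)"
    and ab: "a = b" "0 < b" and BM: "standard_brownian_motion N B"
  defines "R \<equiv> (\<lambda>\<omega>. sqrt ((1 - a) / a) * (- (1 / 2) * B 1 \<omega> + (SUP t\<in>{0..1}. B t \<omega>)))"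
  shows "\<exists>\<nu> :: (real ^ 2) measure.
            prob_space \<nu> \<and> sets \<nu> = sets borel \<and>
            weakly_converges
              (\<lambda>n. distr M borel (\<lambda>\<omega>. vector
                 [(real (row_len X 1 n \<omega>) - real n / 2) / sqrt (real n),
                  (real (row_len X 2 n \<omega>) - real n / 2) / sqrt (real n)]))
              \<nu> \<and>
            measure \<nu> {y. \<exists>x. y = vector [x, - x]} = 1 \<and>
            distr \<nu> borel (\<lambda>y. y $ 1) = distr N borel R"
proof -
  interpret two_letter_chain a b by fact
  interpret mixing_chain a b using ab by unfold_locales simp
  note lim = char_top_row_symmetric[OF ab(1) BM, folded R_def]
  interpret \<nu>: real_distribution "distr N borel R" by (rule lim(2))
  let ?\<nu> = "distr (distr N borel R) borel antidiag"
  interpret A: prob_space ?\<nu> by (rule \<nu>.prob_space_distr) simp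
  have "weakly_converges
       (\<lambda>n. distr M borel (\<lambda>\<omega>. vector
          [(real (row_len X 1 n \<omega>) - real n * (1 / 2)) / sqrt (real n),
           (real (row_len X 2 n \<omega>) - real n * (1 / 2)) / sqrt (real n)])) ?\<nu>"
    by (rule weak_limit_of_word_law[OF mc ch lim(2)]) (use lim(1) in simp_all)
  moreover have "measure ?\<nu> {y. \<exists>x. y = vector [x, - x]} = 1"
  proof -
    have eq: "{y. \<exists>x. y = vector [x, - x]} = {y :: real ^ 2. y $ 1 + y $ 2 = 0}"
      by (auto simp: vec_eq_iff forall_2 intro!: exI[of _ "_ $ 1"])
    have "{y :: real ^ 2. y $ 1 + y $ 2 = 0} \<in> sets borel" by measurable
    moreover have "\<nu>.prob UNIV = 1" using \<nu>.prob_space by simp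
    ultimately show ?thesis unfolding eq by (subst measure_distr) auto
  qed
  moreover have "distr ?\<nu> borel (\<lambda>y. y $ 1) = distr N borel R"
    by (subst distr_distr) (auto simp: o_def distr_id2)
  ultimately show ?thesis using A.prob_space_axioms by (intro exI[of _ ?\<nu>]) simp
qed

lemma limit_shape_biased:
  fixes M :: "'w measure"
  assumes ch: "two_letter_chain a b" and mc: "markov_chain M X (init_prob a b) (trans_prob a b)"
    and ab: "a \<noteq> b \<or> a = 0 \<and> b = 0"
  defines "v \<equiv> (if a \<noteq> b then 4 * a * b * (2 - a - b) / (a + b) ^ 3 else 0) / 4"
  shows "\<exists>\<nu>. multivariate_normal \<nu> 0 (v *\<^sub>R (vector [vector [1, -1], vector [-1, 1]] :: real ^ 2 ^ 2)) \<and>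
            weakly_converges
              (\<lambda>n. distr M borel (\<lambda>\<omega>. vector
                 [(real (row_len X 1 n \<omega>) - real n * max (init_prob a b Alpha1) (init_prob a b Alpha2)) / sqrt (real n),
                  (real (row_len X 2 n \<omega>) - real n * min (init_prob a b Alpha1) (init_prob a b Alpha2)) / sqrt (real n)]))
              \<nu>"
proof -
  interpret two_letter_chain a b by fact
  have v: "0 \<le> v" using a01 b01 by (simp add: v_def)
  have lim: "(\<lambda>n. measure_pmf.expectation (word_law n z) (\<lambda>w. iexp (u *
        ((top_row w - n * max (init_prob a b Alpha1) (init_prob a b Alpha2)) / sqrt n)))) \<longlonglongrightarrow> char (normal_law 0 v) u"
    if z: "init_prob a b z \<noteq> 0" for u z
  proof (cases "a = b")
    case False
    interpret mixing_chain a b using False a01 b01 by unfold_locales linarith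
    have "max (init_prob a b Alpha1) (init_prob a b Alpha2) = max a b / (a + b)"
      using False ab_pos by (auto simp: max_divide_distrib_right max.commute)
    moreover have "v = asym_var" using False by (simp add: v_def asym_var_def)
    ultimately show ?thesis using char_top_row_biased[OF False] by simp
  next
    case True
    then have ab0: "a = 0" "b = 0" using ab by auto
    have z1: "z = Alpha1" using z ab0 by (cases z) auto
    \<comment> \<open>Without transitions the chain never leaves its initial letter \<open>Alpha1\<close>, and the word is constant.\<close>
    have stay: "step_law Alpha1 = return_pmf Alpha1"
    proof (rule pmf_eqI)
      fix y show "pmf (step_law Alpha1) y = pmf (return_pmf Alpha1) y"
        unfolding pmf_step_law using ab0 by (cases y) simp_all
    qed
    have w: "word_law n Alpha1 = return_pmf (replicate n Alpha1)" for n
      by (induction n) (simp_all add: stay bind_return_pmf)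
    have "walk_max (replicate n Alpha1) = n \<and> walk_end (replicate n Alpha1) = n" for n
      by (induction n) auto
    then have "top_row (replicate n Alpha1) = n" for n by (simp add: top_row_def)
    then show ?thesis unfolding z1 w using ab0 by (simp add: v_def char_normal_law)
  qed
  have "init_prob a b Alpha1 + init_prob a b Alpha2 = 1"
  proof (cases "a = 0 \<and> b = 0")
    case False
    then have "a + b \<noteq> 0" using a01 b01 by linarith
    then show ?thesis by (auto simp flip: add_divide_distrib simp: add.commute)
  qed simp
  then have sum: "max (init_prob a b Alpha1) (init_prob a b Alpha2) + min (init_prob a b Alpha1) (init_prob a b Alpha2) = 1"
    by (simp add: max_def min_def)
  show ?thesis
    using multivariate_normal_antidiag[OF v]
      weak_limit_of_word_law[OF mc ch real_distribution_normal_law[OF v] lim sum] by blast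
qed

theorem corollary3p1:
  fixes M :: "'w measure" and X :: "nat \<Rightarrow> 'w \<Rightarrow> letter" and a b :: real
  assumes "a \<in> {0..1}" and "b \<in> {0..1}"
    and "markov_chain M X (init_prob a b) (trans_prob a b)"
  shows
    "(a = b \<and> b > 0 \<longrightarrow>
       (\<forall>(N :: 'v measure) B. standard_brownian_motion N B \<longrightarrow>
         (\<exists>\<nu> :: (real ^ 2) measure.
            prob_space \<nu> \<and> sets \<nu> = sets borel \<and>
            weakly_converges
              (\<lambda>n. distr M borel (\<lambda>\<omega>. vector
                 [(real (row_len X 1 n \<omega>) - real n / 2) / sqrt (real n),
                  (real (row_len X 2 n \<omega>) - real n / 2) / sqrt (real n)]))
              \<nu> \<and>
            measure \<nu> {y. \<exists>x. y = vector [x, - x]} = 1 \<and>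
            distr \<nu> borel (\<lambda>y. y $ 1) =
              distr N borel (\<lambda>\<omega>. sqrt ((1 - a) / a) *
                (- (1 / 2) * B 1 \<omega> + (SUP t\<in>{0..1}. B t \<omega>)))))) \<and>
     (a \<noteq> b \<or> a = 0 \<and> b = 0 \<longrightarrow>
       (let \<pi>max = max (init_prob a b Alpha1) (init_prob a b Alpha2);
            \<pi>min = min (init_prob a b Alpha1) (init_prob a b Alpha2);
            \<sigma>2 = (if a \<noteq> b then 4 * a * b * (2 - a - b) / (a + b) ^ 3 else 0);
            \<Sigma> = (\<sigma>2 / 4) *\<^sub>R (vector [vector [1, -1], vector [-1, 1]] :: real ^ 2 ^ 2)
        in \<exists>\<nu> :: (real ^ 2) measure.
            multivariate_normal \<nu> 0 \<Sigma> \<and>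
            weakly_converges
              (\<lambda>n. distr M borel (\<lambda>\<omega>. vector
                 [(real (row_len X 1 n \<omega>) - real n * \<pi>max) / sqrt (real n),
                  (real (row_len X 2 n \<omega>) - real n * \<pi>min) / sqrt (real n)]))
              \<nu>))"
proof -
  have ch: "two_letter_chain a b" using assms(1,2) by unfold_locales auto
  show ?thesis unfolding Let_def
    by (intro conjI impI allI limit_shape_symmetric[OF ch assms(3)] limit_shape_biased[OF ch assms(3)]) auto
qed

end
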